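(* Let $n\ge 5$ be an odd integer. Then the bow-tie graph $C_6\bowtie P_n$ is $3$-extendable.
   Context: $C_m$ denotes the cycle on $m$ vertices and $P_n$ the path on $n$ vertices; $\times$ denotes the Cartesian product of graphs. Label the vertices of $C_m\times P_n$ by $v_{i,j}$ with $i\in[m]=\{1,\dots,m\}$ and $j\in[n]=\{1,\dots,n\}$, where the first subscript $i$ (the position along the cycle $C_m$) is taken modulo $m$ and $j$ is the position along the path $P_n$; thus $v_{i,j}$ is adjacent to $v_{i\pm1,j}$, and $v_{i,j}$ is adjacent to $v_{i,j+1}$ for $1\le j\le n-1$. The bow-tie graph $C_m\bowtie P_n$ is the graph obtained from $C_m\times P_n$ by adding the edges $v_{i,1}v_{m+2-i,\,n}$ for all $i\in[m]$. A $k$-matching is a set of $k$ pairwise disjoint edges. A graph $G$ is $k$-extendable if it has a perfect matching and every $k$-matching of $G$ is contained in a perfect matching of $G$. *)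

theory Defs
  imports Main "HOL-Library.Disjoint_Sets"
begin

text \<open>A simple graph is a pair of a vertex set and a set of two-element edges.\<close>

type_synonym 'a graph = "'a set \<times> 'a set set"

definition verts :: "'a graph \<Rightarrow> 'a set" where
  "verts G = fst G"

definition edges :: "'a graph \<Rightarrow> 'a set set" where
  "edges G = snd G"

text \<open>The representative in \<open>{1..m}\<close> of an index modulo \<open>m\<close> (for \<open>m \<ge> 1\<close>;
  the summand \<open>m\<close> keeps the subtraction from truncating at \<open>k = 0\<close>).\<close>

definition cyc_index :: "nat \<Rightarrow> nat \<Rightarrow> nat" where
  "cyc_index m k = (k + m - 1) mod m + 1"

text \<open>This is a simple cycle for \<open>m \<ge> 3\<close> only.\<close>

definition cycle_graph :: "nat \<Rightarrow> nat graph" where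
  "cycle_graph m = ({1..m}, {{i, cyc_index m (i + 1)} | i. i \<in> {1..m}})"

definition path_graph :: "nat \<Rightarrow> nat graph" where
  "path_graph n = ({1..n}, {{j, j + 1} | j. 1 \<le> j \<and> j < n})"

definition cartesian_product :: "'a graph \<Rightarrow> 'b graph \<Rightarrow> ('a \<times> 'b) graph" where
  "cartesian_product G H =
    (verts G \<times> verts H,
     {{(x, y), (x', y)} | x x' y. {x, x'} \<in> edges G \<and> y \<in> verts H} \<union>
     {{(x, y), (x, y')} | x y y'. x \<in> verts G \<and> {y, y'} \<in> edges H})"

text \<open>The vertex \<open>v\<^sub>i\<^sub>,\<^sub>j\<close> is the pair \<open>(i, j)\<close>.\<close>

definition bow_tie :: "nat \<Rightarrow> nat \<Rightarrow> (nat \<times> nat) graph" where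
  "bow_tie m n =
    (let P = cartesian_product (cycle_graph m) (path_graph n) in
     (verts P,
      edges P \<union> {{(i, 1), (cyc_index m (m + 2 - i), n)} | i. i \<in> {1..m}}))"

definition matching :: "'a graph \<Rightarrow> 'a set set \<Rightarrow> bool" where
  "matching G M \<longleftrightarrow> M \<subseteq> edges G \<and> disjoint M"

text \<open>Finiteness is explicit because an infinite set has cardinality \<open>0\<close>.\<close>

definition k_matching :: "nat \<Rightarrow> 'a graph \<Rightarrow> 'a set set \<Rightarrow> bool" where
  "k_matching k G M \<longleftrightarrow> matching G M \<and> finite M \<and> card M = k"

definition perfect_matching :: "'a graph \<Rightarrow> 'a set set \<Rightarrow> bool" where
  "perfect_matching G M \<longleftrightarrow> matching G M \<and> \<Union> M = verts G"

definition extendable :: "nat \<Rightarrow> 'a graph \<Rightarrow> bool" where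
  "extendable k G \<longleftrightarrow>
    (\<exists>M. perfect_matching G M) \<and>
    (\<forall>M. k_matching k G M \<longrightarrow> (\<exists>M'. perfect_matching G M' \<and> M \<subseteq> M'))"

end

theory Submission
  imports Defs
begin

text \<open>
  View \<open>C\<^sub>6 \<bowtie> P\<^sub>n\<close> as \<open>n\<close> columns, each a 6-cycle, arranged in a circle. Consecutive columns
  are joined row by row, except that the reflection \<open>i \<mapsto> 2 - i\<close> of the rows is applied between
  column \<open>n\<close> and column \<open>1\<close>. Call the place between two consecutive columns a seam. Moving every
  column one step along the circle is an automorphism (\<open>shift_automorphism\<close>), so all seams look
  alike, the one with the reflection included. The proof is by induction on odd \<open>n\<close> in steps of two,
  for matchings with at most three edges.

  The step from \<open>m\<close> to \<open>m + 2\<close> columns rests on one observation. Suppose a perfect matching of the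
  graph with \<open>m\<close> columns crosses some seam exactly in the rows of a set \<open>W\<close>. Insert two columns
  there: the rows of \<open>W\<close> are now matched on either side of the new pair of columns, and the other
  rows are matched inside the pair (\<open>mate_lift\<close>). So a matching \<open>M\<close> can be treated by deleting the
  two columns at a seam whenever the edges of \<open>M\<close> that touch these columns all lie in the seam
  between them; such a seam is called clear for \<open>M\<close>. An edge inside a column spoils the two seams
  next to the column, and an edge in a seam spoils the two neighbouring seams. Three edges spoil at
  most six seams, so for at least seven columns a clear seam exists (\<open>ex_clear_seam\<close>).

  After the deletion, an edge of \<open>M\<close> in the clear seam and row \<open>i\<close> becomes the requirement that the
  smaller matching does not cross in row \<open>i\<close>. It is enforced by another edge at one of the two
  vertices concerned, chosen so that the result is again a matching with at most three edges
  (\<open>replacement\<close>).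

  The case of five columns is a finite check. By symmetry one of the three edges may be taken from
  four representatives. For each of them a list of about forty perfect matchings is given such that
  any two further disjoint edges are found together in one member of the list (\<open>certifies\<close>,
  \<open>covers_follows\<close>).
\<close>

section \<open>The bow-tie graph in coordinates\<close>

text \<open>The two directions along the 6-cycle, and the reflection that occurs between the last and
  the first column.\<close>

definition up :: "nat \<Rightarrow> nat" where "up i = cyc_index 6 (i + 1)"
definition down :: "nat \<Rightarrow> nat" where "down i = cyc_index 6 (i + 5)"
definition mirror :: "nat \<Rightarrow> nat" where "mirror i = cyc_index 6 (8 - i)"

lemma rows: "i \<in> {1..6} \<longleftrightarrow> i = 1 \<or> i = 2 \<or> i = 3 \<or> i = 4 \<or> i = 5 \<or> (i::nat) = 6"
  by auto

lemma row_tables [simp]: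
  "up 1 = 2" "up (Suc 0) = 2" "up 2 = 3" "up 3 = 4" "up 4 = 5" "up 5 = 6" "up 6 = 1"
  "down 1 = 6" "down (Suc 0) = 6" "down 2 = 1" "down 3 = 2" "down 4 = 3" "down 5 = 4" "down 6 = 5"
  "mirror 1 = 1" "mirror (Suc 0) = 1" "mirror 2 = 6" "mirror 3 = 5" "mirror 4 = 4" "mirror 5 = 3"
  "mirror 6 = 2"
  by (simp_all add: up_def down_def mirror_def cyc_index_def)

lemma row_laws:
  assumes "i \<in> {1..6}"
  shows "up i \<in> {1..6}" "down i \<in> {1..6}" "mirror i \<in> {1..6}"
    "down (up i) = i" "up (down i) = i" "mirror (mirror i) = i"
    "mirror (up i) = down (mirror i)" "mirror (down i) = up (mirror i)"
    "up i \<noteq> i" "down i \<noteq> i" "up i \<noteq> down i" "up (up i) \<noteq> down i"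
  using assms[unfolded rows] by (elim disjE; simp)+

text \<open>Each vertex has one neighbour in each of the directions up, down, left and right. Moves to the
  left of the first column or to the right of the last one pass through the reflection; because it
  is an involution, left and right remain opposite there.\<close>

datatype dir = U | D | L | R

fun opp :: "dir \<Rightarrow> dir" where
  "opp U = D" | "opp D = U" | "opp L = R" | "opp R = L"

fun step :: "nat \<Rightarrow> dir \<Rightarrow> nat \<times> nat \<Rightarrow> nat \<times> nat" where
  "step n U (i, j) = (up i, j)"
| "step n D (i, j) = (down i, j)"
| "step n R (i, j) = (if j = n then (mirror i, 1) else (i, j + 1))"
| "step n L (i, j) = (if j = 1 then (mirror i, n) else (i, j - 1))"

definition cells :: "nat \<Rightarrow> (nat \<times> nat) set" where
  "cells n = {1..6} \<times> {1..n}"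

definition links :: "nat \<Rightarrow> (nat \<times> nat) set set" where
  "links n = {{v, step n d v} | v d. v \<in> cells n}"

lemma linkI: "v \<in> cells n \<Longrightarrow> {v, step n d v} \<in> links n"
  unfolding links_def by blast

lemma step_in_cells: "v \<in> cells n \<Longrightarrow> step n d v \<in> cells n"
  using row_laws(1-3)[of "fst v"] by (cases v; cases d) (auto simp: cells_def)

lemma step_opp: "v \<in> cells n \<Longrightarrow> step n (opp d) (step n d v) = v"
  by (cases v; cases d) (auto simp: cells_def row_laws)

lemma step_neq: "n \<ge> 2 \<Longrightarrow> v \<in> cells n \<Longrightarrow> step n d v \<noteq> v"
  by (cases v; cases d) (auto simp: cells_def row_laws)

lemma finite_links: "finite (links n)"
proof -
  have "links n \<subseteq> Pow (cells n)" by (auto simp: links_def step_in_cells)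
  then show ?thesis by (rule finite_subset) (simp add: cells_def)
qed

lemma verts_bow_tie: "verts (bow_tie 6 n) = cells n"
  by (simp add: bow_tie_def cartesian_product_def cycle_graph_def path_graph_def verts_def cells_def Let_def)

text \<open>Every edge is met once going up or to the right, which halves later case distinctions.\<close>

lemma links_forward: "links n = {{v, step n d v} | v d. v \<in> cells n \<and> d \<in> {U, R}}"
proof (intro subset_antisym subsetI)
  fix e assume "e \<in> links n"
  then obtain v d where e: "e = {v, step n d v}" "v \<in> cells n" by (auto simp: links_def)
  show "e \<in> {{v, step n d v} | v d. v \<in> cells n \<and> d \<in> {U, R}}"
  proof (cases "d \<in> {U, R}")
    case False
    then have "opp d \<in> {U, R}" by (cases d) auto
    moreover have "e = {step n d v, step n (opp d) (step n d v)}" using e step_opp by auto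
    ultimately show ?thesis using step_in_cells[OF e(2)] by blast
  qed (use e in blast)
qed (auto simp: links_def)

lemma edges_bow_tie:
  assumes "n \<ge> 1"
  shows "edges (bow_tie 6 n) = links n" (is "?L = _")
proof -
  have path: "{y, y'} \<in> snd (path_graph n) \<longleftrightarrow>
      (1 \<le> y \<and> y < n \<and> y' = y + 1 \<or> 1 \<le> y' \<and> y' < n \<and> y = y' + 1)" for y y'
    unfolding path_graph_def snd_conv mem_Collect_eq doubleton_eq_iff by blast
  have cyc: "{x, x'} \<in> snd (cycle_graph 6) \<longleftrightarrow> (x \<in> {1..6} \<and> x' = up x \<or> x' \<in> {1..6} \<and> x = up x')" for x x'
    unfolding cycle_graph_def snd_conv mem_Collect_eq doubleton_eq_iff up_def by blast
  have L: "?L = {{(x, y), (x', y)} | x x' y. {x, x'} \<in> snd (cycle_graph 6) \<and> y \<in> {1..n}} \<union>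
     {{(x, y), (x, y')} | x y y'. x \<in> {1..6} \<and> {y, y'} \<in> snd (path_graph n)} \<union>
     {{(i, 1), (mirror i, n)} | i. i \<in> {1..6}}"
    by (simp add: bow_tie_def cartesian_product_def edges_def Let_def mirror_def verts_def path_graph_def
        cycle_graph_def)
  show ?thesis
  proof (intro subset_antisym subsetI)
    fix e assume "e \<in> ?L"
    then consider x y where "e = {(x, y), (up x, y)}" "x \<in> {1..6}" "y \<in> {1..n}"
      | x y where "e = {(x, y), (x, y + 1)}" "x \<in> {1..6}" "1 \<le> y" "y < n"
      | i where "e = {(i, 1), (mirror i, n)}" "i \<in> {1..6}"
    proof -
      from \<open>e \<in> ?L\<close>
      consider x x' y where "e = {(x, y), (x', y)}" "y \<in> {1..n}"
          "x \<in> {1..6} \<and> x' = up x \<or> x' \<in> {1..6} \<and> x = up x'"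
        | x y y' where "e = {(x, y), (x, y')}" "x \<in> {1..6}"
          "1 \<le> y \<and> y < n \<and> y' = y + 1 \<or> 1 \<le> y' \<and> y' < n \<and> y = y' + 1"
        | i where "e = {(i, 1), (mirror i, n)}" "i \<in> {1..6}"
        unfolding L cyc path by blast
      then show thesis
      proof cases
        case (1 x x' y)
        then show thesis using that(1)[of x y] that(1)[of x' y] by (metis insert_commute)
      next
        case (2 x y y')
        then show thesis using that(2)[of x y] that(2)[of x y'] by (metis insert_commute)
      next
        case (3 i)
        then show thesis by (rule that(3))
      qed
    qed
    then show "e \<in> links n"
    proof cases
      case (1 x y)
      then have "e = {(x, y), step n U (x, y)}" "(x, y) \<in> cells n" by (auto simp: cells_def)
      then show ?thesis unfolding links_def by blast
    next
      case (2 x y)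
      then have "e = {(x, y), step n R (x, y)}" "(x, y) \<in> cells n" by (auto simp: cells_def)
      then show ?thesis unfolding links_def by blast
    next
      case (3 i)
      then have "e = {(i, 1), step n L (i, 1)}" "(i, 1) \<in> cells n" using assms by (auto simp: cells_def)
      then show ?thesis unfolding links_def by blast
    qed
  next
    fix e assume "e \<in> links n"
    then obtain i j d where e: "e = {(i, j), step n d (i, j)}" "i \<in> {1..6}" "j \<in> {1..n}" "d \<in> {U, R}"
      unfolding links_forward cells_def by blast
    consider "d = U" | "d = R" "j < n" | "d = R" "j = n" using e by fastforce
    then show "e \<in> ?L"
    proof cases
      case 1
      then have "e = {(i, j), (up i, j)}" using e by simp
      with e(2,3) have "\<exists>x x' y. e = {(x, y), (x', y)} \<and>
          (x \<in> {1..6} \<and> x' = up x \<or> x' \<in> {1..6} \<and> x = up x') \<and> y \<in> {1..n}" by metis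
      then show ?thesis unfolding L cyc by simp
    next
      case 2
      then have "e = {(i, j), (i, j + 1)}" using e by simp
      moreover have "1 \<le> j" using e(3) by simp
      ultimately have "\<exists>x y y'. e = {(x, y), (x, y')} \<and> x \<in> {1..6} \<and>
          (1 \<le> y \<and> y < n \<and> y' = y + 1 \<or> 1 \<le> y' \<and> y' < n \<and> y = y' + 1)"
        using e(2) \<open>j < n\<close> by metis
      then show ?thesis unfolding L path by simp
    next
      case 3
      then have "e = {(mirror i, 1), (mirror (mirror i), n)}" using e by (auto simp: row_laws(6))
      moreover note row_laws(3)[OF e(2)]
      ultimately show ?thesis unfolding L by blast
    qed
  qed
qed

section \<open>Matchings as involutions\<close>

text \<open>A perfect matching is represented by the map that sends each vertex to its partner. Such a map
  has no fixed points, so it contains the edge \<open>e\<close> exactly if it maps \<open>e\<close> onto itself.\<close>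

definition mate :: "nat \<Rightarrow> (nat \<times> nat \<Rightarrow> nat \<times> nat) \<Rightarrow> bool" where
  "mate n f \<longleftrightarrow> (\<forall>v \<in> cells n. {v, f v} \<in> links n \<and> f (f v) = v)"

definition extends :: "nat \<Rightarrow> (nat \<times> nat) set set \<Rightarrow> bool" where
  "extends n M \<longleftrightarrow> (\<exists>f. mate n f \<and> (\<forall>e \<in> M. f ` e = e))"

text \<open>At most three edges, and not exactly three, because the edges that replace those of a clear seam
  may coincide.\<close>

definition small_matching :: "nat \<Rightarrow> (nat \<times> nat) set set \<Rightarrow> bool" where
  "small_matching n M \<longleftrightarrow> M \<subseteq> links n \<and> disjoint M \<and> card M \<le> 3"

lemma links_subset_cells: "e \<in> links n \<Longrightarrow> e \<subseteq> cells n"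
  by (auto simp: links_def step_in_cells)

lemma links_doubleton:
  assumes "e \<in> links n" "v \<in> e" "n \<ge> 2"
  obtains w where "e = {v, w}" "w \<noteq> v"
proof -
  obtain u d where u: "e = {u, step n d u}" "u \<in> cells n" using assms(1) unfolding links_def by blast
  note neq = step_neq[OF assms(3) u(2), of d]
  consider "v = u" | "v = step n d u" using assms(2) u by blast
  then show thesis
  proof cases
    case 1
    then show thesis using that[of "step n d u"] u neq by simp
  next
    case 2
    then show thesis using that[of u] u neq by auto
  qed
qed

lemma mate_in_cells: "mate n f \<Longrightarrow> v \<in> cells n \<Longrightarrow> f v \<in> cells n"
  unfolding mate_def using links_subset_cells by blast

lemma mate_neq:
  assumes "mate n f" "v \<in> cells n" "n \<ge> 2" shows "f v \<noteq> v"
proof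
  assume "f v = v"
  then have "{v} \<in> links n" using assms(1,2) unfolding mate_def by force
  then obtain w where "{v} = {v, w}" "w \<noteq> v" using links_doubleton[of "{v}" n v] assms(3) by blast
  then show False by blast
qed

lemma perfect_matching_of_mate:
  assumes "extends n M" "M \<subseteq> links n" "n \<ge> 2"
  shows "\<exists>M'. perfect_matching (bow_tie 6 n) M' \<and> M \<subseteq> M'"
proof -
  obtain f where f: "mate n f" "\<forall>e \<in> M. f ` e = e" using assms unfolding extends_def by blast
  let ?P = "(\<lambda>v. {v, f v}) ` cells n"
  have "disjoint ?P"
  proof (rule disjointI)
    fix a b assume "a \<in> ?P" "b \<in> ?P" "a \<noteq> b"
    then obtain v w where vw: "a = {v, f v}" "b = {w, f w}" "v \<in> cells n" "w \<in> cells n" by blast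
    have "f (f v) = v" "f (f w) = w" using f(1) vw unfolding mate_def by blast+
    then have "v \<noteq> w" "f v \<noteq> f w" "v \<noteq> f w" "f v \<noteq> w"
      using \<open>a \<noteq> b\<close> vw(1,2) by (metis insert_commute)+
    then show "a \<inter> b = {}" using vw by blast
  qed
  moreover have "?P \<subseteq> links n" using f(1) unfolding mate_def by blast
  moreover have "\<Union> ?P = cells n" using mate_in_cells[OF f(1)] by auto
  moreover have "M \<subseteq> ?P"
  proof
    fix e assume e: "e \<in> M"
    then obtain v d where v: "e = {v, step n d v}" "v \<in> cells n"
      using assms(2) unfolding links_def by blast
    have "f v \<in> e" using f(2)[rule_format, OF e] v(1) by (metis imageI insertI1)
    moreover have "f v \<noteq> v" using mate_neq[OF f(1) v(2)] assms(3) by simp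
    ultimately have "f v = step n d v" using v(1) by (metis insertE singletonD)
    then have "e = {v, f v}" using v(1) by simp
    then show "e \<in> ?P" using v by blast
  qed
  ultimately show ?thesis
    using assms unfolding perfect_matching_def matching_def
    by (auto simp: verts_bow_tie edges_bow_tie intro!: exI[of _ ?P])
qed

section \<open>Symmetries\<close>

definition automorphism :: "nat \<Rightarrow> (nat \<times> nat \<Rightarrow> nat \<times> nat) \<Rightarrow> bool" where
  "automorphism n h \<longleftrightarrow> bij_betw h (cells n) (cells n) \<and> (\<forall>e \<in> links n. h ` e \<in> links n)"

lemma automorphismI:
  assumes "\<And>v. v \<in> cells n \<Longrightarrow> h v \<in> cells n" "\<And>v. v \<in> cells n \<Longrightarrow> h' v \<in> cells n"
    "\<And>v. v \<in> cells n \<Longrightarrow> h' (h v) = v" "\<And>v. v \<in> cells n \<Longrightarrow> h (h' v) = v"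
    "\<And>v. v \<in> cells n \<Longrightarrow> {h v, h (step n U v)} \<in> links n"
    "\<And>v. v \<in> cells n \<Longrightarrow> {h v, h (step n R v)} \<in> links n"
  shows "automorphism n h"
  unfolding automorphism_def
proof
  show "bij_betw h (cells n) (cells n)"
    by (rule bij_betw_byWitness[where f' = h']) (use assms in auto)
  show "\<forall>e \<in> links n. h ` e \<in> links n"
    using assms(5,6) unfolding links_forward by (auto simp: links_forward[symmetric])
qed

text \<open>Conjugating the partner map by \<open>h\<close> moves an extension of the image back. The definition of an
  automorphism demands that edges go to edges; the converse, which the conjugation needs, holds
  because \<open>h\<close> acts injectively on the finite set of edges.\<close>

lemma extends_automorphism:
  assumes h: "automorphism n h" and M: "M \<subseteq> links n" and ext: "extends n ((`) h ` M)"
  shows "extends n M"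
proof -
  have bij: "bij_betw h (cells n) (cells n)" using h by (simp add: automorphism_def)
  have onto: "(`) h ` links n = links n"
  proof (rule endo_inj_surj[OF finite_links])
    show "(`) h ` links n \<subseteq> links n" using h by (auto simp: automorphism_def)
    show "inj_on ((`) h) (links n)"
      using bij links_subset_cells by (meson bij_betw_def inj_on_image_eq_iff inj_onI)
  qed
  define k where "k = inv_into (cells n) h"
  have k: "k v \<in> cells n" "h (k v) = v" if "v \<in> cells n" for v
    using bij that unfolding k_def by (auto simp: bij_betw_def inv_into_into f_inv_into_f)
  have hk: "h v \<in> cells n" "k (h v) = v" if "v \<in> cells n" for v
    using bij that unfolding k_def by (auto simp: bij_betw_def)
  have k_link: "k ` e \<in> links n" if "e \<in> links n" for e
  proof -
    obtain e' where e': "e' \<in> links n" "e = h ` e'" using onto \<open>e \<in> links n\<close> by blast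
    have "k ` h ` e' = e'" using hk links_subset_cells[OF e'(1)] by (force simp: image_iff)
    then show ?thesis using e' by simp
  qed
  obtain f where f: "mate n f" "\<forall>e \<in> M. f ` h ` e = h ` e" using ext unfolding extends_def by auto
  let ?g = "k \<circ> f \<circ> h"
  have "mate n ?g"
    unfolding mate_def
  proof (intro ballI conjI)
    fix v assume v: "v \<in> cells n"
    note fh = mate_in_cells[OF f(1) hk(1)[OF v]]
    have "{h v, f (h v)} \<in> links n" using f(1) hk v unfolding mate_def by blast
    from k_link[OF this] show "{v, ?g v} \<in> links n" using hk v by simp
    show "?g (?g v) = v" using f(1) hk k v fh unfolding mate_def by simp
  qed
  moreover have "?g ` e = e" if "e \<in> M" for e
  proof -
    have "?g ` e = k ` f ` h ` e" by (simp add: image_comp)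
    also have "\<dots> = k ` h ` e" using f(2) that by simp
    also have "\<dots> = e" using hk links_subset_cells[of e n] M that by (force simp: image_iff)
    finally show ?thesis .
  qed
  ultimately show ?thesis unfolding extends_def by blast
qed

lemma small_matching_automorphism:
  assumes h: "automorphism n h" and M: "small_matching n M"
  shows "small_matching n ((`) h ` M)"
  unfolding small_matching_def
proof (intro conjI)
  have inj: "inj_on h (cells n)" using h by (simp add: automorphism_def bij_betw_def)
  have MV: "e \<subseteq> cells n" if "e \<in> M" for e using M links_subset_cells that unfolding small_matching_def by blast
  show "(`) h ` M \<subseteq> links n" using h M unfolding automorphism_def small_matching_def by blast
  show "disjoint ((`) h ` M)"
  proof (rule disjointI)
    fix a b assume "a \<in> (`) h ` M" "b \<in> (`) h ` M" "a \<noteq> b"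
    then obtain a' b' where ab: "a' \<in> M" "b' \<in> M" "a = h ` a'" "b = h ` b'" "a' \<noteq> b'" by blast
    then have "a' \<inter> b' = {}" using M unfolding small_matching_def disjoint_def by blast
    then show "a \<inter> b = {}"
      using ab inj_on_image_Int[OF inj MV MV] by (metis image_empty)
  qed
  have "finite M" using M finite_links finite_subset unfolding small_matching_def by blast
  then show "card ((`) h ` M) \<le> 3"
    using M card_image_le[of M "(`) h"] unfolding small_matching_def by linarith
qed

text \<open>The step to the right moves column \<open>n\<close> onto column \<open>1\<close> and reflects it, which turns upward
  edges into downward ones.\<close>

lemma shift_automorphism: "automorphism n (step n R)"
proof (rule automorphismI[where h' = "step n L"])
  fix v assume v: "v \<in> cells n"
  then obtain i j where ij: "v = (i, j)" "i \<in> {1..6}" "j \<in> {1..n}" by (auto simp: cells_def)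
  note w = step_in_cells[OF v, of R]
  have "step n R (step n U v) = step n U (step n R v) \<or> step n R (step n U v) = step n D (step n R v)"
    using ij by (simp add: row_laws)
  then show "{step n R v, step n R (step n U v)} \<in> links n" using linkI[OF w] by metis
  show "{step n R v, step n R (step n R v)} \<in> links n" using linkI[OF w] by metis
qed (use step_in_cells step_opp[of _ n R] step_opp[of _ n L] in auto)

lemma reflection_automorphism: "automorphism n (apfst mirror)"
proof (rule automorphismI[where h' = "apfst mirror"])
  fix v assume v: "v \<in> cells n"
  then obtain i j where ij: "v = (i, j)" "i \<in> {1..6}" "j \<in> {1..n}" by (auto simp: cells_def)
  show w: "apfst mirror v \<in> cells n" using ij row_laws(3)[OF ij(2)] by (simp add: cells_def)
  then show "apfst mirror v \<in> cells n" .
  show "apfst mirror (apfst mirror v) = v" using ij by (simp add: row_laws)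
  then show "apfst mirror (apfst mirror v) = v" .
  have "apfst mirror (step n U v) = step n D (apfst mirror v)" using ij by (simp add: row_laws)
  then show "{apfst mirror v, apfst mirror (step n U v)} \<in> links n" using linkI[OF w] by metis
  have "apfst mirror (step n R v) = step n R (apfst mirror v)" using ij by (simp add: row_laws)
  then show "{apfst mirror v, apfst mirror (step n R v)} \<in> links n" using linkI[OF w] by metis
qed

text \<open>The half turn is the only nontrivial rotation of the 6-cycle that commutes with the reflection
  \<open>i \<mapsto> 2 - i\<close>, so it extends to the whole graph.\<close>

definition turn :: "nat \<Rightarrow> nat" where "turn i = up (up (up i))"

lemma turn_laws:
  assumes "i \<in> {1..6}"
  shows "turn i \<in> {1..6}" "turn (turn i) = i" "turn (up i) = up (turn i)" "turn (mirror i) = mirror (turn i)"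
  using assms[unfolded rows] by (elim disjE; simp add: turn_def)+

lemma half_turn_automorphism: "automorphism n (apfst turn)"
proof (rule automorphismI[where h' = "apfst turn"])
  fix v assume v: "v \<in> cells n"
  then obtain i j where ij: "v = (i, j)" "i \<in> {1..6}" "j \<in> {1..n}" by (auto simp: cells_def)
  show w: "apfst turn v \<in> cells n" using ij turn_laws(1)[OF ij(2)] by (simp add: cells_def)
  then show "apfst turn v \<in> cells n" .
  show "apfst turn (apfst turn v) = v" using ij by (simp add: turn_laws)
  then show "apfst turn (apfst turn v) = v" .
  have "apfst turn (step n U v) = step n U (apfst turn v)" using ij by (simp add: turn_laws)
  then show "{apfst turn v, apfst turn (step n U v)} \<in> links n" using linkI[OF w] by metis
  have "apfst turn (step n R v) = step n R (apfst turn v)" using ij by (simp add: turn_laws)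
  then show "{apfst turn v, apfst turn (step n R v)} \<in> links n" using linkI[OF w] by metis
qed

section \<open>Clear seams\<close>

text \<open>Seam \<open>s\<close> lies between column \<open>s\<close> and the next column. It is clear for an edge that avoids both
  columns or lies in the seam itself.\<close>

definition next_col :: "nat \<Rightarrow> nat \<Rightarrow> nat" where
  "next_col n s = (if s = n then 1 else s + 1)"

definition clear :: "nat \<Rightarrow> nat \<Rightarrow> (nat \<times> nat) set \<Rightarrow> bool" where
  "clear n s e \<longleftrightarrow> snd ` e \<inter> {s, next_col n s} = {} \<or> snd ` e = {s, next_col n s}"

lemma columns_of_link:
  assumes "e \<in> links n"
  obtains j where "j \<in> {1..n}" "snd ` e = {j}" | j where "j \<in> {1..n}" "snd ` e = {j, next_col n j}"
proof -
  obtain i j d where e: "e = {(i, j), step n d (i, j)}" "j \<in> {1..n}" "d \<in> {U, R}"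
    using assms unfolding links_forward cells_def by blast
  then show thesis using that by (auto simp: next_col_def split: if_splits)
qed

text \<open>The spoiled seams are the two next to the column of \<open>e\<close>, or the two neighbours of the seam in
  which \<open>e\<close> lies.\<close>

lemma card_spoiled_seams:
  assumes "e \<in> links n"
  shows "card {s \<in> {1..n}. \<not> clear n s e} \<le> 2"
proof -
  define prev where "prev j = (if j = 1 then n else j - 1)" for j
  have prev: "next_col n s = j \<longleftrightarrow> s = prev j" if "s \<in> {1..n}" "j \<in> {1..n}" for s j
    using that by (auto simp: next_col_def prev_def)
  have next_in: "next_col n s \<in> {1..n}" if "s \<in> {1..n}" for s
    using that by (auto simp: next_col_def)
  have two: "card A \<le> 2" if "A \<subseteq> {a, b}" for A and a b :: nat
    using card_mono[OF _ that] card_insert_le_m1[of 2 "{b}" a] by (simp add: le_trans)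
  from assms show ?thesis
  proof (cases rule: columns_of_link)
    case (1 j)
    have "s = j \<or> s = prev j" if "s \<in> {1..n}" "\<not> clear n s e" for s
      using that 1 prev[OF that(1) 1(1)] by (auto simp: clear_def)
    then show ?thesis by (intro two[of _ j "prev j"]) blast
  next
    case (2 j)
    have "s = next_col n j \<or> s = prev j" if s: "s \<in> {1..n}" "\<not> clear n s e" for s
    proof -
      have "s \<noteq> j" using s 2 unfolding clear_def by auto
      moreover have "next_col n s \<noteq> next_col n j"
        using prev[OF s(1) next_in[OF 2(1)]] prev[OF 2(1) next_in[OF 2(1)]] \<open>s \<noteq> j\<close> by metis
      moreover have "s \<in> {j, next_col n j} \<or> next_col n s \<in> {j, next_col n j}"
        using s(2) 2(2) unfolding clear_def by auto
      ultimately show ?thesis using prev[OF s(1) 2(1)] by blast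
    qed
    then show ?thesis by (intro two[of _ "next_col n j" "prev j"]) blast
  qed
qed

lemma ex_clear_seam:
  assumes M: "small_matching n M" and n: "n \<ge> 7"
  shows "\<exists>s \<in> {1..n}. \<forall>e \<in> M. clear n s e"
proof (rule ccontr)
  assume no: "\<not> ?thesis"
  have fin: "finite M" using M finite_links finite_subset unfolding small_matching_def by blast
  let ?B = "\<lambda>e. {s \<in> {1..n}. \<not> clear n s e}"
  have "{1..n} \<subseteq> (\<Union>e \<in> M. ?B e)" using no by blast
  then have "card {1..n} \<le> card (\<Union>e \<in> M. ?B e)" using fin by (intro card_mono) auto
  also have "\<dots> \<le> (\<Sum>e \<in> M. card (?B e))" by (rule card_UN_le[OF fin])
  also have "\<dots> \<le> of_nat (card M) * 2"
    by (rule sum_bounded_above) (use M card_spoiled_seams in \<open>auto simp: small_matching_def\<close>)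
  also have "\<dots> \<le> 6" using M unfolding small_matching_def by simp
  finally show False using n by simp
qed

lemma snd_shift: "snd (step n R v) = next_col n (snd v)"
  by (cases v) (simp add: next_col_def)

lemma clear_shift:
  assumes "e \<in> links n" "s \<in> {1..n}" "clear n s e"
  shows "clear n (next_col n s) (step n R ` e)"
proof -
  have inj: "inj_on (next_col n) {1..n}" by (auto simp: inj_on_def next_col_def split: if_splits)
  have img: "snd ` step n R ` e = next_col n ` snd ` e"
    by (simp add: image_image snd_shift)
  have sub: "snd ` e \<subseteq> {1..n}" "{s, next_col n s} \<subseteq> {1..n}"
    using links_subset_cells[OF assms(1)] assms(2) by (auto simp: cells_def next_col_def)
  from assms(3) show ?thesis
    unfolding clear_def img using inj_on_image_Int[OF inj sub] by (elim disjE) simp_all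
qed

section \<open>Inserting two columns\<close>

text \<open>The two new columns are appended as columns \<open>m + 1\<close> and \<open>m + 2\<close>, into the seam between column
  \<open>m\<close> and column \<open>1\<close>. An edge of the graph with \<open>m\<close> columns remains an edge unless it lies in
  this seam, which means that it meets exactly the columns \<open>1\<close> and \<open>m\<close>. The bound \<open>m \<ge> 3\<close>
  keeps these two columns from being adjacent in any other way.\<close>

lemma link_wrap:
  assumes "{(i, m), (i', 1)} \<in> links m" "m \<ge> 3"
  shows "i' = mirror i"
proof -
  obtain a b d where e: "{(i, m), (i', 1)} = {(a, b), step m d (a, b)}" "a \<in> {1..6}" "b \<in> {1..m}" "d \<in> {U, R}"
    using assms unfolding links_forward cells_def by blast
  show ?thesis using e assms(2) by (auto simp: doubleton_eq_iff split: if_splits)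
qed

lemma link_widen:
  assumes "e \<in> links m" "snd ` e \<noteq> {1, m}"
  shows "e \<in> links (m + 2)"
proof -
  obtain i j d where e: "e = {(i, j), step m d (i, j)}" "i \<in> {1..6}" "j \<in> {1..m}" "d \<in> {U, R}"
    using assms unfolding links_forward cells_def by blast
  have "d = R \<Longrightarrow> j \<noteq> m" using e(1) assms(2) by auto
  then have "step m d (i, j) = step (m + 2) d (i, j)" using e(3,4) by auto
  moreover have "(i, j) \<in> cells (m + 2)" using e by (auto simp: cells_def)
  ultimately show ?thesis using e(1) linkI by metis
qed

lemma link_narrow:
  assumes "e \<in> links (m + 2)" "snd ` e \<subseteq> {1..m}" "m \<ge> 3"
  shows "e \<in> links m" "snd ` e \<noteq> {1, m}"
proof -
  obtain i j d where e: "e = {(i, j), step (m + 2) d (i, j)}" "i \<in> {1..6}" "j \<in> {1..m + 2}" "d \<in> {U, R}"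
    using assms unfolding links_forward cells_def by blast
  have j: "j \<in> {1..m}" using e(1) assms(2) by auto
  have "d = R \<Longrightarrow> j < m" using e(1) j assms(2) by auto
  then have "step (m + 2) d (i, j) = step m d (i, j)" using e(4) j by auto
  moreover have "(i, j) \<in> cells m" using e j by (auto simp: cells_def)
  ultimately show "e \<in> links m" using e(1) linkI by metis
  show "snd ` e \<noteq> {1, m}" using e j assms(3) \<open>d = R \<Longrightarrow> j < m\<close> by (auto simp: doubleton_eq_iff)
qed

text \<open>In the rows where \<open>f\<close> crosses from column \<open>m\<close> to column \<open>1\<close>, the crossing edge is replaced by
  the edges before and after the new pair of columns; in the other rows the two new vertices are
  matched with each other.\<close>

fun lift :: "nat \<Rightarrow> (nat \<times> nat \<Rightarrow> nat \<times> nat) \<Rightarrow> nat \<times> nat \<Rightarrow> nat \<times> nat" where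
  "lift m f (i, j) =
    (if j = m + 1 then (if f (i, m) = (mirror i, 1) then (i, m) else (i, m + 2))
     else if j = m + 2 then (if f (i, m) = (mirror i, 1) then (mirror i, 1) else (i, m + 1))
     else if j = m \<and> f (i, m) = (mirror i, 1) then (i, m + 1)
     else if j = 1 \<and> f (i, 1) = (mirror i, m) then (mirror i, m + 2)
     else f (i, j))"

lemma mate_lift:
  assumes f: "mate m f" and m: "m \<ge> 3"
  shows "mate (m + 2) (lift m f)"
  unfolding mate_def
proof
  fix v assume "v \<in> cells (m + 2)"
  then obtain i j where v: "v = (i, j)" "i \<in> {1..6}" "j \<in> {1..m + 2}" by (auto simp: cells_def)
  have ff: "f (f u) = u" "{u, f u} \<in> links m" "f u \<in> cells m" if "u \<in> cells m" for u
    using f that mate_in_cells[OF f that] unfolding mate_def by blast+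
  have mm: "mirror (mirror i) = i" "mirror i \<in> {1..6}" using row_laws(3,6)[OF v(2)] by auto
  have im: "(i, m) \<in> cells m" "(i, 1) \<in> cells m" using v m by (auto simp: cells_def)
  let ?W = "f (i, m) = (mirror i, 1)"
  consider "j = m + 1" "?W" | "j = m + 1" "\<not> ?W" | "j = m + 2" "?W" | "j = m + 2" "\<not> ?W"
    | "j = m" "?W" | "j = 1" "f (i, 1) = (mirror i, m)"
    | "j \<le> m" "\<not> (j = m \<and> ?W)" "\<not> (j = 1 \<and> f (i, 1) = (mirror i, m))"
    using v(3) by fastforce
  then show "{v, lift m f v} \<in> links (m + 2) \<and> lift m f (lift m f v) = v"
  proof cases
    case 1
    then have "lift m f v = step (m + 2) L v" using v m by simp
    moreover have "lift m f (lift m f v) = v" using 1 v m by simp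
    ultimately show ?thesis using linkI[of v "m + 2" L] \<open>v \<in> cells (m + 2)\<close> by simp
  next
    case 2
    then have "lift m f v = step (m + 2) R v" using v m by simp
    moreover have "lift m f (lift m f v) = v" using 2 v m by simp
    ultimately show ?thesis using linkI[of v "m + 2" R] \<open>v \<in> cells (m + 2)\<close> by simp
  next
    case 3
    then have "lift m f v = step (m + 2) R v" using v m by simp
    moreover have "f (mirror i, 1) = (i, m)" using ff(1)[OF im(1)] 3 by simp
    then have "lift m f (lift m f v) = v" using 3 v m mm by simp
    ultimately show ?thesis using linkI[of v "m + 2" R] \<open>v \<in> cells (m + 2)\<close> by simp
  next
    case 4
    then have "lift m f v = step (m + 2) L v" using v m by simp
    moreover have "lift m f (lift m f v) = v" using 4 v m by simp
    ultimately show ?thesis using linkI[of v "m + 2" L] \<open>v \<in> cells (m + 2)\<close> by simp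
  next
    case 5
    then have "lift m f v = step (m + 2) R v" using v m by simp
    moreover have "lift m f (lift m f v) = v" using 5 v m by simp
    ultimately show ?thesis using linkI[of v "m + 2" R] \<open>v \<in> cells (m + 2)\<close> by simp
  next
    case 6
    then have "lift m f v = step (m + 2) L v" using v m by simp
    moreover have "f (mirror i, m) = (i, 1)" using ff(1)[OF im(2)] 6 by simp
    then have "lift m f (lift m f v) = v" using 6 v m mm by simp
    ultimately show ?thesis using linkI[of v "m + 2" L] \<open>v \<in> cells (m + 2)\<close> by simp
  next
    (* The vertex keeps its partner. As f does not cross from column m to column 1 here, the edge to
       the partner survives the insertion. *)
    case 7
    have vm: "v \<in> cells m" using 7 v by (auto simp: cells_def)
    obtain i' j' where w: "f v = (i', j')" by force
    have w': "i' \<in> {1..6}" "j' \<in> {1..m}" using ff(3)[OF vm] w by (auto simp: cells_def)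
    have fw: "f (i', j') = (i, j)" using ff(1)[OF vm] w v by simp
    have mm': "mirror (mirror i') = i'" by (rule row_laws(6)[OF w'(1)])
    have lv: "lift m f v = (i', j')" using 7 v w by auto
    moreover have "lift m f (i', j') = v" using 7 fw w w' v m mm mm' by auto
    moreover have "snd ` {v, f v} \<noteq> {1, m}"
    proof
      assume "snd ` {v, f v} = {1, m}"
      then have "j = m \<and> j' = 1 \<or> j = 1 \<and> j' = m" using v w m by (auto simp: doubleton_eq_iff)
      then show False
      proof
        assume *: "j = m \<and> j' = 1"
        then have "i' = mirror i" using link_wrap[of i m i'] ff(2)[OF vm] v w m by simp
        then show False using * 7(2) v w by simp
      next
        assume *: "j = 1 \<and> j' = m"
        then have "i = mirror i'" using link_wrap[of i' m i] ff(2)[OF vm] v w m by (simp add: insert_commute)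
        then show False using * 7(3) v w mm' by simp
      qed
    qed
    ultimately show ?thesis using link_widen[OF ff(2)[OF vm]] w by simp
  qed
qed

lemma lift_keeps:
  assumes "e \<in> links m" "snd ` e \<noteq> {1, m}" "f ` e = e" "mate m f" "m \<ge> 3"
  shows "lift m f ` e = e"
proof -
  have "lift m f u = f u" if u: "u \<in> e" for u
  proof -
    obtain i j where ij: "u = (i, j)" by force
    obtain w where w: "e = {u, w}" "w \<noteq> u" using links_doubleton[OF assms(1) u] assms(5) by auto
    have "u \<in> cells m" using links_subset_cells[OF assms(1)] u by blast
    then have "f u \<noteq> u" using mate_neq[OF assms(4)] assms(5) by simp
    moreover have "f u \<in> e" using assms(3) u by blast
    ultimately have "f u = w" using w by blast
    then have "snd ` e = {j, snd (f u)}" using w ij by simp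
    then have "\<not> (j = m \<and> f u = (mirror i, 1))" "\<not> (j = 1 \<and> f u = (mirror i, m))"
      using assms(2) by auto
    moreover have "j \<le> m" using \<open>u \<in> cells m\<close> ij by (simp add: cells_def)
    ultimately show ?thesis using ij by auto
  qed
  then show ?thesis using assms(3) by (metis image_cong)
qed

section \<open>Replacing the edges of the clear seam\<close>

text \<open>For a fixed column \<open>c\<close> the dominoes form a perfect matching of its 6-cycle, with rows
  \<open>1, 2\<close>, rows \<open>3, 4\<close> and rows \<open>5, 6\<close> paired.\<close>

definition domino :: "nat \<Rightarrow> nat \<Rightarrow> (nat \<times> nat) set" where
  "domino c i = (if odd i then {(i, c), (i + 1, c)} else {(i - 1, c), (i, c)})"

lemma domino:
  assumes "i \<in> {1..6}" "c \<in> {1..n}"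
  shows "domino c i \<in> links n" "(i, c) \<in> domino c i" "snd ` domino c i = {c}"
proof -
  have "{(1, c), step n U (1, c)} \<in> links n" "{(3, c), step n U (3, c)} \<in> links n"
    "{(5, c), step n U (5, c)} \<in> links n"
    by (rule linkI; use assms in \<open>simp add: cells_def\<close>)+
  then show "domino c i \<in> links n"
    using assms(1)[unfolded rows] by (elim disjE) (simp_all add: domino_def flip: numeral_2_eq_2)
  show "(i, c) \<in> domino c i" "snd ` domino c i = {c}" by (auto simp: domino_def)
qed

lemma domino_disjoint:
  assumes "i \<in> {1..6}" "k \<in> {1..6}"
  shows "domino c i = domino c k \<or> domino c i \<inter> domino c k = {}"
  using assms[unfolded rows] by (elim disjE) (simp_all add: domino_def flip: numeral_2_eq_2)

text \<open>If \<open>e\<close> misses the vertex \<open>(i, c)\<close>, it also misses the vertex above or the one below, as these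
  two are not adjacent.\<close>

lemma vertical_cover:
  assumes e: "e \<in> links n" "n \<ge> 2" and i: "i \<in> {1..6}" "c \<in> {1..n}"
  obtains g where "g \<in> links n" "(i, c) \<in> g" "g = e \<or> g \<inter> e = {} \<and> snd ` g = {c}"
proof -
  have v: "(i, c) \<in> cells n" using i by (simp add: cells_def)
  have g: "{(i, c), (up i, c)} \<in> links n" "{(i, c), (down i, c)} \<in> links n"
    using linkI[OF v, of U] linkI[OF v, of D] by auto
  consider "(i, c) \<in> e" | "(i, c) \<notin> e" "(up i, c) \<notin> e" | "(i, c) \<notin> e" "(down i, c) \<notin> e"
    | "(up i, c) \<in> e" "(down i, c) \<in> e" by blast
  then show thesis
  proof cases
    case 1
    then show thesis using that[OF e(1)] by blast
  next
    case 2
    then show thesis using that[OF g(1)] by auto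
  next
    case 3
    then show thesis using that[OF g(2)] by auto
  next
    case 4
    obtain w where w: "e = {(up i, c), w}" using links_doubleton[OF e(1) 4(1) e(2)] .
    have "w = (down i, c)" using 4(2) w row_laws(11)[OF i(1)] by auto
    with w e(1) obtain a b d where ab: "{(up i, c), (down i, c)} = {(a, b), step n d (a, b)}" "a \<in> {1..6}" "d \<in> {U, R}"
      unfolding links_forward cells_def by blast
    have False using ab e(2) row_laws[OF i(1)]
      by (auto simp: doubleton_eq_iff split: if_splits)
    then show thesis ..
  qed
qed

text \<open>Here \<open>T\<close> is the set of rows in which the clear seam contains an edge, and \<open>M\<close> is the rest of the
  matching. A row \<open>i\<close> is blocked for crossing once \<open>(i, m)\<close> or its neighbour \<open>(mirror i, 1)\<close> is
  covered by an edge that lies outside the seam. If \<open>M\<close> avoids column \<open>1\<close> or column \<open>m\<close>, dominoes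
  in that column block all rows of \<open>T\<close>. Otherwise two different edges of \<open>M\<close> meet these
  columns, so that \<open>T\<close> has at most one row, which \<open>vertical_cover\<close> blocks in column \<open>m\<close>.\<close>

lemma replacement:
  assumes m: "m \<ge> 5" and M: "M \<subseteq> links m" "disjoint M" "\<And>e. e \<in> M \<Longrightarrow> snd ` e \<noteq> {1, m}"
    and T: "T \<subseteq> {1..6}" "card M + card T \<le> 3"
  obtains N where "small_matching m N" "M \<subseteq> N"
    "\<And>i. i \<in> T \<Longrightarrow> \<exists>g \<in> N. snd ` g \<noteq> {1, m} \<and> ((i, m) \<in> g \<or> (mirror i, 1) \<in> g)"
proof -
  have fin: "finite M" "finite T" using finite_subset[OF M(1) finite_links] finite_subset[OF T(1)] by auto
  show thesis
  proof (cases "\<exists>c \<in> {1, m}. \<forall>e \<in> M. c \<notin> snd ` e")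
    case True
    then obtain c where c: "c \<in> {1, m}" "\<And>e. e \<in> M \<Longrightarrow> c \<notin> snd ` e" by blast
    define h where "h i = (if c = m then i else mirror i)" for i
    have h: "h i \<in> {1..6}" if "i \<in> T" for i
      using row_laws(3)[of i] T(1) that unfolding h_def by auto
    have cm: "c \<in> {1..m}" using c(1) m by auto
    note dom = domino[OF h cm]
    let ?N = "M \<union> (\<lambda>i. domino c (h i)) ` T"
    have "disjoint ?N"
    proof (rule disjoint_union[OF M(2)])
      show "disjoint ((\<lambda>i. domino c (h i)) ` T)"
      proof (rule disjointI)
        fix a b assume "a \<in> (\<lambda>i. domino c (h i)) ` T" "b \<in> (\<lambda>i. domino c (h i)) ` T" "a \<noteq> b"
        then obtain i k where "a = domino c (h i)" "b = domino c (h k)" "i \<in> T" "k \<in> T" by blast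
        then show "a \<inter> b = {}" using domino_disjoint[OF h h, of i k c] \<open>a \<noteq> b\<close> by simp
      qed
      show "\<Union> M \<inter> \<Union> ((\<lambda>i. domino c (h i)) ` T) = {}"
      proof -
        have "v \<notin> domino c (h i)" if "v \<in> e" "e \<in> M" "i \<in> T" for v e i
          using c(2)[OF that(2)] dom(3)[OF that(3)] that(1) by (metis imageI singletonD)
        then show ?thesis by blast
      qed
    qed
    moreover have "?N \<subseteq> links m" using M(1) dom(1) by blast
    moreover have "card ?N \<le> card M + card T"
      using card_Un_le[of M "(\<lambda>i. domino c (h i)) ` T"] card_image_le[OF fin(2), of "\<lambda>i. domino c (h i)"]
      by linarith
    ultimately have "small_matching m ?N" using T(2) unfolding small_matching_def by simp
    moreover have "\<exists>g \<in> ?N. snd ` g \<noteq> {1, m} \<and> ((i, m) \<in> g \<or> (mirror i, 1) \<in> g)" if "i \<in> T" for i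
    proof -
      have "snd ` domino c (h i) \<noteq> {1, m}" using dom(3)[OF that] m by auto
      moreover have "(i, m) \<in> domino c (h i) \<or> (mirror i, 1) \<in> domino c (h i)"
        using dom(2)[OF that] c(1) unfolding h_def by (auto split: if_splits)
      ultimately show ?thesis using that by blast
    qed
    ultimately show thesis using that[of ?N] by blast
  next
    case False
    then obtain a b where ab: "a \<in> M" "b \<in> M" "1 \<in> snd ` a" "m \<in> snd ` b" by blast
    have a: "m \<notin> snd ` a"
    proof
      assume "m \<in> snd ` a"
      moreover have "a \<in> links m" using ab M by blast
      ultimately have "snd ` a = {1, m}"
        using ab(3) m by (elim columns_of_link) auto
      then show False using M(3) ab by blast
    qed
    then have "a \<noteq> b" using ab by blast
    show thesis
    proof (cases "T = {}")
      case True
      then show thesis using that[of M] M T unfolding small_matching_def by simp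
    next
      case False
      then have "card T \<ge> 1" using fin by (simp add: Suc_le_eq card_gt_0_iff)
      moreover have "card {a, b} \<le> card M" using ab fin by (intro card_mono) auto
      ultimately have cards: "card T = 1" "card M = 2" using T(2) \<open>a \<noteq> b\<close> by auto
      then obtain i where i: "T = {i}" using card_1_singletonE by blast
      have Mab: "M = {a, b}" using card_subset_eq[OF fin(1), of "{a, b}"] ab cards \<open>a \<noteq> b\<close> by auto
      have "b \<in> links m" "i \<in> {1..6}" "m \<in> {1..m}" "m \<ge> 2" using ab M T i m by auto
      then obtain g where g: "g \<in> links m" "(i, m) \<in> g" "g = b \<or> g \<inter> b = {} \<and> snd ` g = {m}"
        using vertical_cover by metis
      have ga: "g = b \<or> g \<inter> a = {}"
        using a g(3) by (metis disjoint_iff imageI singletonD)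
      have snd_g: "snd ` g \<noteq> {1, m}"
        using g(3) M(3)[OF ab(2)] m by auto
      have "disjoint (insert g M)"
        using M(2) g(3) ga unfolding Mab by (auto simp: disjoint_def)
      moreover have "card (insert g M) \<le> 3" using card_insert_le_m1[of 3 M g] cards by simp
      ultimately have "small_matching m (insert g M)"
        using g(1) M(1) unfolding small_matching_def by simp
      then show thesis using that[of "insert g M"] g(2) i snd_g by blast
    qed
  qed
qed

section \<open>The induction step\<close>

text \<open>An edge of \<open>M\<close> in the clear seam and row \<open>i\<close> is an edge of the lifted matching unless \<open>f\<close> crosses
  from \<open>(i, m)\<close> to \<open>(mirror i, 1)\<close>. It does not cross there, because it contains an edge outside the
  seam that covers one of these two vertices.\<close>

lemma extends_two_more_columns:
  assumes IH: "\<And>N. small_matching m N \<Longrightarrow> extends m N" and m: "m \<ge> 5"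
    and M: "small_matching (m + 2) M" "\<And>e. e \<in> M \<Longrightarrow> clear (m + 2) (m + 1) e"
  shows "extends (m + 2) M"
proof -
  define T where "T = {i \<in> {1..6}. {(i, m + 1), (i, m + 2)} \<in> M}"
  define M1 where "M1 = {e \<in> M. snd ` e \<subseteq> {1..m}}"
  define M0 where "M0 = (\<lambda>i. {(i, m + 1), (i, m + 2)}) ` T"
  have links: "e \<in> links (m + 2)" if "e \<in> M" for e using that M unfolding small_matching_def by blast
  have fin: "finite M" using M finite_links finite_subset unfolding small_matching_def by blast
  have split: "M = M1 \<union> M0"
  proof (intro subset_antisym subsetI)
    fix e assume e: "e \<in> M"
    obtain i j d where ij: "e = {(i, j), step (m + 2) d (i, j)}" "i \<in> {1..6}" "j \<in> {1..m + 2}" "d \<in> {U, R}"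
      using links[OF e] unfolding links_forward cells_def by blast
    from M(2)[OF e] show "e \<in> M1 \<union> M0"
      unfolding clear_def
    proof
      assume "snd ` e \<inter> {m + 1, next_col (m + 2) (m + 1)} = {}"
      then have "m + 1 \<notin> snd ` e" "m + 2 \<notin> snd ` e" by (auto simp: next_col_def)
      moreover have "snd ` e \<subseteq> {1..m + 2}" using links_subset_cells[OF links[OF e]] by (auto simp: cells_def)
      moreover have "{1..m + 2} = insert (m + 1) (insert (m + 2) {1..m})" by auto
      ultimately have "snd ` e \<subseteq> {1..m}" by (simp add: subset_insert)
      then show ?thesis using e unfolding M1_def by blast
    next
      assume "snd ` e = {m + 1, next_col (m + 2) (m + 1)}"
      then have "e = {(i, m + 1), (i, m + 2)}"
        using ij m by (auto simp: next_col_def doubleton_eq_iff)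
      then show ?thesis using e ij(2) unfolding M0_def T_def by blast
    qed
  next
    fix e assume "e \<in> M1 \<union> M0"
    then show "e \<in> M" unfolding M1_def M0_def T_def by blast
  qed
  have cards: "card M1 + card T \<le> 3"
  proof -
    have "M1 \<inter> M0 = {}" unfolding M1_def M0_def by auto
    moreover have "card M0 = card T"
      unfolding M0_def by (rule card_image) (auto simp: inj_on_def doubleton_eq_iff)
    ultimately have "card M = card M1 + card T" using split fin by (metis card_Un_disjoint finite_Un)
    then show ?thesis using M unfolding small_matching_def by simp
  qed
  have narrow: "e \<in> links m" "snd ` e \<noteq> {1, m}" if "e \<in> M1" for e
    using link_narrow[of e m] links that m unfolding M1_def by auto
  have "disjoint M1"
    using M(1) unfolding M1_def small_matching_def disjoint_def by blast
  moreover have "T \<subseteq> {1..6}" unfolding T_def by blast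
  moreover have "M1 \<subseteq> links m" using narrow(1) by blast
  ultimately obtain N where N: "small_matching m N" "M1 \<subseteq> N"
    and cover: "\<And>i. i \<in> T \<Longrightarrow> \<exists>g \<in> N. snd ` g \<noteq> {1, m} \<and> ((i, m) \<in> g \<or> (mirror i, 1) \<in> g)"
    using replacement[OF m _ _ narrow(2) _ cards] by metis
  obtain f where f: "mate m f" "\<And>e. e \<in> N \<Longrightarrow> f ` e = e" using IH[OF N(1)] unfolding extends_def by metis
  have "lift m f ` e = e" if "e \<in> M" for e
  proof -
    consider "e \<in> M1" | i where "e = {(i, m + 1), (i, m + 2)}" "i \<in> T"
      using split \<open>e \<in> M\<close> unfolding M0_def by blast
    then show ?thesis
    proof cases
      case 1
      then show ?thesis using lift_keeps[OF narrow[OF 1] f(2)[of e] f(1)] N(2) m by auto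
    next
      case (2 i)
      have "f (i, m) \<noteq> (mirror i, 1)"
      proof
        assume W: "f (i, m) = (mirror i, 1)"
        have "(i, m) \<in> cells m" using 2(2) m unfolding T_def cells_def by auto
        then have W': "f (mirror i, 1) = (i, m)" using f(1) W unfolding mate_def by metis
        obtain g where g: "g \<in> N" "snd ` g \<noteq> {1, m}" "(i, m) \<in> g \<or> (mirror i, 1) \<in> g"
          using cover[OF 2(2)] by blast
        have both: "(i, m) \<in> g" "(mirror i, 1) \<in> g"
          using g(3) f(2)[OF g(1)] W W' by (metis imageI)+
        have "g \<in> links m" using g(1) N(1) unfolding small_matching_def by blast
        moreover have "m \<ge> 2" using m by simp
        ultimately obtain w where "g = {(i, m), w}" using links_doubleton[OF _ both(1)] by metis
        then have "g = {(i, m), (mirror i, 1)}" using both(2) m by auto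
        then show False using g(2) by (simp add: insert_commute)
      qed
      then show ?thesis using 2 by auto
    qed
  qed
  moreover have "mate (m + 2) (lift m f)" using mate_lift[OF f(1)] m by simp
  ultimately show ?thesis unfolding extends_def by blast
qed

text \<open>Rotating the columns brings an arbitrary clear seam to the position \<open>m + 1\<close>.\<close>

lemma small_matching_extends_step:
  assumes IH: "\<And>N. small_matching m N \<Longrightarrow> extends m N" and m: "m \<ge> 5"
    and M: "small_matching (m + 2) M"
  shows "extends (m + 2) M"
proof -
  let ?n = "m + 2"
  define P where "P s \<longleftrightarrow> (\<forall>M. small_matching ?n M \<and> (\<forall>e \<in> M. clear ?n s e) \<longrightarrow> extends ?n M)" for s
  have shift: "P s" if s: "s \<in> {1..?n}" "P (next_col ?n s)" for s
    unfolding P_def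
  proof (intro allI impI, elim conjE)
    fix M assume M: "small_matching ?n M" "\<forall>e \<in> M. clear ?n s e"
    let ?M = "(`) (step ?n R) ` M"
    have links: "M \<subseteq> links ?n" using M unfolding small_matching_def by blast
    have "\<forall>e \<in> ?M. clear ?n (next_col ?n s) e" using clear_shift s(1) M(2) links by blast
    then have "extends ?n ?M"
      using s(2) small_matching_automorphism[OF shift_automorphism M(1)] unfolding P_def by blast
    then show "extends ?n M" by (rule extends_automorphism[OF shift_automorphism links])
  qed
  have P0: "P (m + 1)" unfolding P_def using extends_two_more_columns[OF IH m] by blast
  have P1: "P s" if "s \<le> m + 1" "1 \<le> s" for s
    using that
  proof (induction rule: inc_induct)
    case base
    show ?case by (rule P0)
  next
    case (step k)
    then show ?case using shift[of k] by (simp add: next_col_def)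
  qed
  have "P ?n" using shift[of ?n] P1[of 1] by (simp add: next_col_def)
  then have "P s" if "s \<in> {1..?n}" for s using P1[of s] that by (cases "s = ?n") auto
  moreover obtain s where "s \<in> {1..?n}" "\<forall>e \<in> M. clear ?n s e" using ex_clear_seam[OF M] m by auto
  ultimately show ?thesis using M unfolding P_def by blast
qed

section \<open>Certificates for five columns\<close>

text \<open>A grid lists, column by column and in each column by rows, the direction in which the partner of
  each vertex lies. An arrow, a vertex with a direction, stands for the edge in that direction.\<close>

type_synonym grid = "dir list list"
type_synonym arrow = "(nat \<times> nat) \<times> dir"

definition dir_at :: "grid \<Rightarrow> nat \<times> nat \<Rightarrow> dir" where
  "dir_at g v = g ! (snd v - 1) ! (fst v - 1)"

definition cell_list :: "(nat \<times> nat) list" where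
  "cell_list = List.product [1, 2, 3, 4, 5, 6] [1, 2, 3, 4, 5]"

definition arrow_list :: "arrow list" where
  "arrow_list = List.product cell_list [U, R]"

definition edge_of :: "arrow \<Rightarrow> (nat \<times> nat) set" where
  "edge_of a = {fst a, step 5 (snd a) (fst a)}"

definition apart :: "arrow \<Rightarrow> arrow \<Rightarrow> bool" where
  "apart a b \<longleftrightarrow> (let v = fst a; v' = step 5 (snd a) v; w = fst b; w' = step 5 (snd b) w in
     v \<noteq> w \<and> v \<noteq> w' \<and> v' \<noteq> w \<and> v' \<noteq> w')"

definition follows :: "arrow \<Rightarrow> grid \<Rightarrow> bool" where
  "follows a g \<longleftrightarrow> dir_at g (fst a) = snd a"

definition consistent :: "grid \<Rightarrow> bool" where
  "consistent g \<longleftrightarrow> list_all (\<lambda>v. dir_at g (step 5 (dir_at g v) v) = opp (dir_at g v)) cell_list"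

text \<open>\<open>covers k as gs\<close> decides whether any at most \<open>k\<close> pairwise disjoint edges from \<open>as\<close> lie together
  in one of the perfect matchings \<open>gs\<close>. The recursion either uses the first arrow, after which only
  the arrows apart from it and the grids that follow it matter, or drops it.\<close>

fun covers :: "nat \<Rightarrow> arrow list \<Rightarrow> grid list \<Rightarrow> bool" where
  "covers 0 as gs \<longleftrightarrow> gs \<noteq> []"
| "covers (Suc k) [] gs \<longleftrightarrow> gs \<noteq> []"
| "covers (Suc k) (a # as) gs \<longleftrightarrow>
     covers k (filter (apart a) as) (filter (follows a) gs) \<and> covers (Suc k) as gs"

definition certifies :: "arrow \<Rightarrow> grid list \<Rightarrow> bool" where
  "certifies a gs \<longleftrightarrow> list_all (\<lambda>g. consistent g \<and> follows a g) gs \<and>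
     covers 2 (filter (apart a) arrow_list) gs"

lemma apart_iff: "apart a b \<longleftrightarrow> edge_of a \<inter> edge_of b = {}"
  by (auto simp: apart_def edge_of_def Let_def)

lemma set_cell_list: "set cell_list = cells 5"
proof -
  have "{1..5} = {1, 2, 3, 4, 5::nat}" "{1..6} = {1, 2, 3, 4, 5, 6::nat}" by auto
  then show ?thesis unfolding cell_list_def cells_def by simp
qed

lemma links_5: "links 5 = edge_of ` set arrow_list"
  unfolding links_forward arrow_list_def edge_of_def set_product set_cell_list by force

lemma mate_of_grid:
  assumes "consistent g"
  shows "mate 5 (\<lambda>v. step 5 (dir_at g v) v)"
  unfolding mate_def
proof (intro ballI conjI)
  fix v assume v: "v \<in> cells 5"
  show "{v, step 5 (dir_at g v) v} \<in> links 5" by (rule linkI[OF v])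
  have "dir_at g (step 5 (dir_at g v) v) = opp (dir_at g v)"
    using assms v unfolding consistent_def list_all_iff set_cell_list by blast
  then show "step 5 (dir_at g (step 5 (dir_at g v) v)) (step 5 (dir_at g v) v) = v"
    using step_opp[OF v] by simp
qed

lemma covers_follows:
  assumes "covers k as gs" "S \<subseteq> set as" "finite S" "card S \<le> k" "pairwise apart S"
  shows "\<exists>g \<in> set gs. \<forall>a \<in> S. follows a g"
  using assms
proof (induction k as gs arbitrary: S rule: covers.induct)
  case (1 as gs)
  then have "S = {}" by simp
  then show ?case using 1(1) by (cases gs) auto
next
  case (2 k gs)
  then show ?case by (cases gs) auto
next
  case (3 k a as gs)
  show ?case
  proof (cases "a \<in> S")
    case True
    let ?S = "S - {a}"
    have "?S \<subseteq> set (filter (apart a) as)"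
      using 3(4) 3(7) True unfolding pairwise_def by auto
    moreover have "card ?S \<le> k" using 3(5,6) True by simp
    moreover have "pairwise apart ?S" using 3(7) by (auto simp: pairwise_def)
    ultimately obtain g where "g \<in> set (filter (follows a) gs)" "\<forall>b \<in> ?S. follows b g"
      using 3(1)[of ?S] 3(3,5) by auto
    then show ?thesis by auto
  next
    case False
    then have "S \<subseteq> set as" using 3(4) by auto
    then show ?thesis using 3(2)[of S] 3(3,5-7) by auto
  qed
qed

text \<open>The other edges of \<open>M\<close>, at most two, are written as arrows that are apart from \<open>a\<close> and from each
  other; \<open>covers_follows\<close> then provides one grid for all of them.\<close>

lemma extends_of_certificate:
  assumes cert: "certifies a gs" and M: "small_matching 5 M" "edge_of a \<in> M" and a: "fst a \<in> cells 5"
  shows "extends 5 M"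
proof -
  have "\<exists>b \<in> set arrow_list. edge_of b = e" if "e \<in> M" for e
    using M(1) that unfolding small_matching_def links_5 by blast
  then obtain c where c: "\<And>e. e \<in> M \<Longrightarrow> c e \<in> set arrow_list" "\<And>e. e \<in> M \<Longrightarrow> edge_of (c e) = e"
    by metis
  have disj: "d \<inter> e = {}" if "d \<in> M" "e \<in> M" "d \<noteq> e" for d e
    using M(1) that unfolding small_matching_def disjoint_def by blast
  have fin: "finite M" using M finite_links finite_subset unfolding small_matching_def by blast
  define S where "S = c ` (M - {edge_of a})"
  have "S \<subseteq> set (filter (apart a) arrow_list)"
  proof -
    have "apart a (c e)" if "e \<in> M" "e \<noteq> edge_of a" for e
      using disj[OF M(2) that(1)] that c(2)[OF that(1)] by (simp add: apart_iff)
    then show ?thesis using c(1) unfolding S_def image_subset_iff set_filter by blast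
  qed
  moreover have "card S \<le> 2"
  proof -
    have "card S \<le> card (M - {edge_of a})" unfolding S_def by (rule card_image_le) (use fin in simp)
    also have "\<dots> = card M - 1" using M(2) fin by simp
    also have "\<dots> \<le> 2" using M(1) unfolding small_matching_def by linarith
    finally show ?thesis .
  qed
  moreover have "pairwise apart S"
    unfolding S_def
  proof (rule pairwise_imageI)
    fix d e assume de: "d \<in> M - {edge_of a}" "e \<in> M - {edge_of a}" "d \<noteq> e"
    then have "d \<inter> e = {}" using disj by simp
    then show "apart (c d) (c e)" using de c(2) by (simp add: apart_iff)
  qed
  moreover have "finite S" unfolding S_def using fin by simp
  ultimately obtain g where g: "g \<in> set gs" "\<forall>b \<in> S. follows b g"
    using covers_follows cert unfolding certifies_def by metis
  let ?f = "\<lambda>v. step 5 (dir_at g v) v"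
  have ga: "consistent g" "follows a g" using cert g(1) unfolding certifies_def list_all_iff by auto
  have f: "mate 5 ?f" by (rule mate_of_grid[OF ga(1)])
  have keep: "?f ` edge_of b = edge_of b" if "follows b g" "fst b \<in> cells 5" for b
  proof -
    have fb: "?f (fst b) = step 5 (snd b) (fst b)" using that(1) unfolding follows_def by simp
    moreover have "?f (?f (fst b)) = fst b" using f that(2) unfolding mate_def by blast
    ultimately show ?thesis unfolding edge_of_def by (simp add: insert_commute)
  qed
  have "?f ` e = e" if "e \<in> M" for e
  proof (cases "e = edge_of a")
    case True
    then show ?thesis using keep[OF ga(2) a] by simp
  next
    case False
    then have "follows (c e) g" using g(2) that unfolding S_def by blast
    moreover have "fst (c e) \<in> cells 5"
      using c(1)[OF that] unfolding arrow_list_def set_product set_cell_list by auto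
    ultimately show ?thesis using keep[of "c e"] c(2)[OF that] by simp
  qed
  then show ?thesis using f unfolding extends_def by blast
qed

text \<open>The lists were obtained by a greedy covering of the pairs of edges disjoint from the given one
  by perfect matchings through it.\<close>

definition grids_1U :: "grid list" where
  "grids_1U = [
    [[U,D,U,D,U,D], [R,U,D,U,D,R], [L,U,D,U,D,L], [D,U,D,R,R,U], [D,U,D,L,L,U]],
    [[U,D,R,R,R,R], [U,D,L,L,L,L], [U,D,U,D,R,R], [R,R,R,R,L,L], [L,L,L,L,U,D]],
    [[U,D,L,U,D,L], [D,R,R,R,R,U], [D,L,L,L,L,U], [U,D,U,D,U,D], [D,R,U,D,R,U]],
    [[U,D,U,D,U,D], [U,D,U,D,U,D], [R,R,R,R,U,D], [L,L,L,L,R,R], [U,D,U,D,L,L]],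
    [[U,D,L,L,L,L], [D,U,D,U,D,U], [U,D,U,D,U,D], [R,U,D,U,D,R], [L,R,R,R,R,L]],
    [[U,D,R,R,L,L], [R,R,L,L,U,D], [L,L,R,U,D,R], [U,D,L,U,D,L], [D,R,R,U,D,U]],
    [[U,D,R,L,L,R], [U,D,L,R,R,L], [D,U,D,L,L,U], [D,U,D,U,D,U], [U,D,R,R,U,D]],
    [[U,D,U,D,U,D], [D,R,R,U,D,U], [D,L,L,R,R,U], [R,R,R,L,L,R], [L,L,L,U,D,L]],
    [[U,D,R,U,D,R], [U,D,L,U,D,L], [R,R,U,D,U,D], [L,L,U,D,U,D], [D,U,D,U,D,U]],
    [[U,D,L,L,R,R], [R,R,U,D,L,L], [L,L,R,R,R,R], [U,D,L,L,L,L], [D,U,D,R,R,U]],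
    [[U,D,U,D,U,D], [R,U,D,R,R,R], [L,U,D,L,L,L], [R,R,U,D,U,D], [L,L,U,D,U,D]],
    [[U,D,L,R,R,L], [U,D,R,L,L,R], [R,R,L,U,D,L], [L,L,R,R,U,D], [D,R,L,L,R,U]],
    [[U,D,U,D,R,R], [R,U,D,R,L,L], [L,U,D,L,U,D], [U,D,R,R,R,R], [U,D,L,L,L,L]],
    [[U,D,R,R,U,D], [U,D,L,L,R,R], [U,D,U,D,L,L], [U,D,U,D,R,R], [U,D,U,D,L,L]],
    [[U,D,U,D,U,D], [D,R,R,U,D,U], [R,L,L,U,D,R], [L,U,D,U,D,L], [U,D,U,D,U,D]],
    [[U,D,L,U,D,L], [U,D,U,D,U,D], [D,U,D,R,R,U], [D,U,D,L,L,U], [D,R,U,D,R,U]],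
    [[U,D,U,D,L,L], [D,U,D,R,R,U], [R,R,R,L,L,R], [L,L,L,R,R,L], [D,R,R,L,L,U]],
    [[U,D,L,L,U,D], [R,R,U,D,U,D], [L,L,U,D,U,D], [D,R,R,U,D,U], [D,L,L,R,R,U]],
    [[U,D,U,D,U,D], [U,D,U,D,U,D], [D,R,R,U,D,U], [R,L,L,R,U,D], [L,U,D,L,U,D]],
    [[U,D,U,D,L,L], [U,D,U,D,R,R], [U,D,R,R,L,L], [U,D,L,L,U,D], [D,R,R,U,D,U]],
    [[U,D,U,D,R,R], [U,D,R,R,L,L], [U,D,L,L,U,D], [D,U,D,U,D,U], [D,U,D,U,D,U]],
    [[U,D,L,R,R,L], [D,U,D,L,L,U], [D,R,U,D,R,U], [D,L,U,D,L,U], [D,R,U,D,R,U]],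
    [[U,D,R,L,L,R], [U,D,L,U,D,L], [R,U,D,U,D,R], [L,R,U,D,R,L], [D,L,R,R,L,U]],
    [[U,D,L,U,D,L], [R,U,D,U,D,R], [L,R,R,U,D,L], [R,L,L,U,D,R], [L,R,U,D,R,L]],
    [[U,D,R,U,D,R], [U,D,L,U,D,L], [U,D,R,R,R,R], [U,D,L,L,L,L], [U,D,U,D,U,D]],
    [[U,D,R,R,U,D], [D,R,L,L,R,U], [D,L,U,D,L,U], [R,U,D,R,R,R], [L,U,D,L,L,L]],
    [[U,D,L,L,L,L], [U,D,R,R,U,D], [R,R,L,L,R,R], [L,L,U,D,L,L], [D,R,R,R,R,U]],
    [[U,D,L,R,R,L], [D,U,D,L,L,U], [R,U,D,R,U,D], [L,U,D,L,U,D], [D,R,U,D,R,U]],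
    [[U,D,L,L,U,D], [R,R,R,R,R,R], [L,L,L,L,L,L], [U,D,R,U,D,R], [U,D,L,R,R,L]],
    [[U,D,U,D,U,D], [U,D,U,D,U,D], [U,D,U,D,U,D], [U,D,U,D,U,D], [U,D,U,D,U,D]],
    [[U,D,R,U,D,R], [U,D,L,U,D,L], [R,U,D,U,D,R], [L,R,R,R,R,L], [D,L,L,L,L,U]],
    [[U,D,U,D,U,D], [R,U,D,U,D,R], [L,U,D,R,R,L], [U,D,R,L,L,R], [U,D,L,U,D,L]],
    [[U,D,U,D,U,D], [D,R,U,D,R,U], [D,L,R,R,L,U], [D,R,L,L,R,U], [D,L,U,D,L,U]],
    [[U,D,U,D,L,L], [U,D,R,U,D,R], [U,D,L,U,D,L], [R,U,D,R,U,D], [L,R,R,L,U,D]],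
    [[U,D,L,L,L,L], [R,U,D,R,U,D], [L,U,D,L,U,D], [U,D,U,D,U,D], [D,R,R,R,R,U]],
    [[U,D,U,D,U,D], [U,D,R,R,R,R], [U,D,L,L,L,L], [R,R,U,D,R,R], [L,L,U,D,L,L]]]"

definition grids_2U :: "grid list" where
  "grids_2U = [
    [[R,U,D,L,L,R], [L,R,R,R,R,L], [D,L,L,L,L,U], [U,D,U,D,R,R], [U,D,R,R,L,L]],
    [[L,U,D,R,R,L], [U,D,R,L,L,R], [U,D,L,U,D,L], [D,U,D,U,D,U], [R,R,U,D,U,D]],
    [[D,U,D,U,D,U], [D,U,D,U,D,U], [R,R,U,D,R,R], [L,L,U,D,L,L], [D,U,D,U,D,U]],
    [[D,U,D,U,D,U], [R,R,U,D,U,D], [L,L,R,R,U,D], [R,R,L,L,U,D], [L,L,U,D,U,D]],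
    [[R,U,D,R,U,D], [L,U,D,L,U,D], [D,U,D,U,D,U], [D,R,R,R,R,U], [D,L,L,L,L,U]],
    [[L,U,D,L,U,D], [U,D,U,D,R,R], [R,R,R,R,L,L], [L,L,L,L,R,R], [R,U,D,R,L,L]],
    [[L,U,D,U,D,L], [R,U,D,R,U,D], [L,U,D,L,U,D], [U,D,R,U,D,R], [R,R,L,U,D,L]],
    [[R,U,D,R,R,R], [L,U,D,L,L,L], [U,D,U,D,U,D], [R,U,D,R,U,D], [L,U,D,L,U,D]],
    [[D,U,D,L,L,U], [R,U,D,U,D,R], [L,U,D,R,R,L], [D,U,D,L,L,U], [U,D,R,R,U,D]],
    [[D,U,D,R,R,U], [D,R,R,L,L,U], [D,L,L,R,R,U], [R,R,R,L,L,R], [L,L,L,U,D,L]],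
    [[L,U,D,L,L,L], [D,R,U,D,R,U], [R,L,U,D,L,R], [L,U,D,U,D,L], [R,R,R,R,U,D]],
    [[D,U,D,U,D,U], [U,D,U,D,U,D], [U,D,U,D,R,R], [U,D,R,R,L,L], [U,D,L,L,U,D]],
    [[R,U,D,U,D,R], [L,U,D,U,D,L], [D,R,R,U,D,U], [D,L,L,U,D,U], [U,D,U,D,U,D]],
    [[R,U,D,R,L,L], [L,U,D,L,R,R], [U,D,R,R,L,L], [U,D,L,L,U,D], [D,R,R,U,D,U]],
    [[L,U,D,L,U,D], [U,D,R,R,U,D], [R,R,L,L,U,D], [L,L,U,D,U,D], [R,U,D,R,U,D]],
    [[R,U,D,R,R,R], [L,U,D,L,L,L], [R,U,D,U,D,R], [L,R,U,D,R,L], [D,L,U,D,L,U]],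
    [[D,U,D,U,D,U], [R,R,R,R,R,R], [L,L,L,L,L,L], [D,U,D,R,R,U], [D,U,D,L,L,U]],
    [[D,U,D,L,L,U], [U,D,R,U,D,R], [U,D,L,U,D,L], [R,R,U,D,R,R], [L,L,R,R,L,L]],
    [[L,U,D,L,R,R], [U,D,U,D,L,L], [D,U,D,U,D,U], [U,D,U,D,U,D], [R,U,D,R,U,D]],
    [[L,U,D,U,D,L], [D,U,D,U,D,U], [R,R,U,D,U,D], [L,L,R,R,R,R], [R,R,L,L,L,L]],
    [[D,U,D,U,D,U], [D,U,D,R,R,U], [U,D,R,L,L,R], [R,R,L,U,D,L], [L,L,U,D,U,D]],
    [[L,U,D,R,R,L], [R,U,D,L,L,R], [L,R,U,D,R,L], [D,L,U,D,L,U], [R,R,U,D,U,D]],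
    [[D,U,D,U,D,U], [U,D,U,D,U,D], [U,D,U,D,U,D], [D,U,D,U,D,U], [D,U,D,U,D,U]],
    [[L,U,D,L,U,D], [D,R,R,U,D,U], [D,L,L,U,D,U], [U,D,U,D,U,D], [R,U,D,R,U,D]],
    [[R,U,D,R,U,D], [L,U,D,L,U,D], [U,D,R,R,R,R], [U,D,L,L,L,L], [U,D,U,D,U,D]],
    [[L,U,D,L,U,D], [R,R,U,D,R,R], [L,L,U,D,L,L], [D,R,R,U,D,U], [R,L,L,R,U,D]],
    [[R,U,D,R,L,L], [L,U,D,L,U,D], [D,R,R,U,D,U], [R,L,L,R,R,R], [L,R,R,L,L,L]],
    [[R,U,D,R,U,D], [L,U,D,L,U,D], [D,U,D,U,D,U], [R,U,D,U,D,R], [L,U,D,U,D,L]],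
    [[R,U,D,R,R,R], [L,R,R,L,L,L], [D,L,L,R,R,U], [U,D,R,L,L,R], [U,D,L,U,D,L]],
    [[D,U,D,L,L,U], [D,U,D,U,D,U], [R,U,D,R,U,D], [L,U,D,L,U,D], [U,D,R,R,U,D]],
    [[L,U,D,L,R,R], [R,R,R,R,L,L], [L,L,L,L,R,R], [U,D,U,D,L,L], [R,U,D,R,U,D]],
    [[D,U,D,L,L,U], [D,U,D,R,R,U], [D,U,D,L,L,U], [D,R,U,D,R,U], [D,L,R,R,L,U]],
    [[R,U,D,U,D,R], [L,R,U,D,R,L], [D,L,U,D,L,U], [R,R,U,D,R,R], [L,L,U,D,L,L]],
    [[L,U,D,U,D,L], [R,U,D,U,D,R], [L,U,D,U,D,L], [U,D,R,R,U,D], [R,R,L,L,U,D]],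
    [[D,U,D,R,R,U], [R,U,D,L,L,R], [L,R,R,R,R,L], [D,L,L,L,L,U], [D,U,D,U,D,U]]]"

definition grids_1R :: "grid list" where
  "grids_1R = [
    [[R,R,R,U,D,R], [L,L,L,U,D,L], [U,D,U,D,U,D], [R,R,U,D,U,D], [L,L,U,D,U,D]],
    [[R,R,U,D,L,L], [L,L,U,D,U,D], [R,R,R,U,D,R], [L,L,L,R,R,L], [D,R,R,L,L,U]],
    [[R,U,D,R,R,R], [L,R,R,L,L,L], [D,L,L,R,R,U], [D,U,D,L,L,U], [D,U,D,U,D,U]],
    [[R,R,L,L,U,D], [L,L,R,R,R,R], [U,D,L,L,L,L], [U,D,R,U,D,R], [U,D,L,R,R,L]],
    [[R,L,L,R,U,D], [L,U,D,L,U,D], [R,U,D,R,U,D], [L,U,D,L,U,D], [U,D,U,D,R,R]],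
    [[R,U,D,L,L,R], [L,U,D,R,R,L], [D,U,D,L,L,U], [R,R,U,D,R,R], [L,L,R,R,L,L]],
    [[R,L,L,U,D,R], [L,U,D,U,D,L], [D,R,U,D,R,U], [D,L,R,R,L,U], [U,D,L,L,R,R]],
    [[R,U,D,U,D,R], [L,U,D,U,D,L], [U,D,R,U,D,R], [U,D,L,U,D,L], [D,U,D,U,D,U]],
    [[R,R,U,D,U,D], [L,L,U,D,R,R], [R,R,U,D,L,L], [L,L,U,D,U,D], [D,U,D,U,D,U]],
    [[R,U,D,R,U,D], [L,R,R,L,U,D], [D,L,L,U,D,U], [R,R,R,R,U,D], [L,L,L,L,U,D]],
    [[R,R,U,D,L,L], [L,L,R,U,D,R], [U,D,L,R,R,L], [R,U,D,L,L,R], [L,R,R,U,D,L]],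
    [[R,R,U,D,R,R], [L,L,U,D,L,L], [D,U,D,U,D,U], [D,U,D,U,D,U], [U,D,U,D,U,D]],
    [[R,L,R,R,L,R], [L,R,L,L,R,L], [R,L,U,D,L,R], [L,U,D,U,D,L], [U,D,R,U,D,R]],
    [[R,R,R,R,U,D], [L,L,L,L,R,R], [U,D,R,R,L,L], [D,R,L,L,R,U], [D,L,U,D,L,U]],
    [[R,R,L,L,R,R], [L,L,U,D,L,L], [R,U,D,R,R,R], [L,R,R,L,L,L], [D,L,L,R,R,U]],
    [[R,R,L,U,D,L], [L,L,R,R,U,D], [R,R,L,L,R,R], [L,L,U,D,L,L], [D,R,U,D,R,U]],
    [[R,R,U,D,R,R], [L,L,U,D,L,L], [U,D,U,D,U,D], [U,D,R,R,R,R], [U,D,L,L,L,L]],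
    [[R,U,D,L,L,R], [L,U,D,U,D,L], [R,R,R,R,U,D], [L,L,L,L,U,D], [U,D,R,R,U,D]],
    [[R,R,R,U,D,R], [L,L,L,R,R,L], [D,U,D,L,L,U], [R,U,D,R,R,R], [L,U,D,L,L,L]],
    [[R,R,R,R,L,L], [L,L,L,L,U,D], [D,U,D,U,D,U], [U,D,U,D,U,D], [D,R,R,U,D,U]],
    [[R,R,L,L,U,D], [L,L,U,D,U,D], [D,R,R,U,D,U], [R,L,L,U,D,R], [L,U,D,R,R,L]],
    [[R,R,L,L,L,L], [L,L,U,D,U,D], [U,D,U,D,U,D], [D,U,D,U,D,U], [D,R,R,R,R,U]],
    [[R,U,D,U,D,R], [L,R,U,D,R,L], [D,L,R,R,L,U], [U,D,L,L,R,R], [U,D,U,D,L,L]],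
    [[R,L,U,D,L,R], [L,R,R,R,R,L], [D,L,L,L,L,U], [R,R,U,D,U,D], [L,L,R,U,D,R]],
    [[R,L,L,R,R,R], [L,U,D,L,L,L], [D,R,R,U,D,U], [R,L,L,R,U,D], [L,U,D,L,R,R]],
    [[R,U,D,R,L,L], [L,U,D,L,R,R], [U,D,U,D,L,L], [R,U,D,R,U,D], [L,R,R,L,U,D]],
    [[R,R,U,D,U,D], [L,L,R,R,U,D], [U,D,L,L,R,R], [U,D,U,D,L,L], [U,D,U,D,U,D]],
    [[R,R,R,R,R,R], [L,L,L,L,L,L], [R,R,U,D,U,D], [L,L,R,U,D,R], [U,D,L,U,D,L]],
    [[R,R,U,D,R,R], [L,L,R,R,L,L], [U,D,L,L,U,D], [D,R,U,D,R,U], [D,L,U,D,L,U]],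
    [[R,L,U,D,L,R], [L,U,D,R,R,L], [U,D,R,L,L,R], [U,D,L,R,R,L], [U,D,R,L,L,R]],
    [[R,L,L,L,L,R], [L,R,R,U,D,L], [R,L,L,R,U,D], [L,U,D,L,U,D], [U,D,R,R,R,R]],
    [[R,R,L,R,R,L], [L,L,R,L,L,R], [R,R,L,U,D,L], [L,L,R,R,U,D], [D,R,L,L,R,U]],
    [[R,R,R,L,L,R], [L,L,L,U,D,L], [U,D,R,R,R,R], [R,R,L,L,L,L], [L,L,R,R,U,D]],
    [[R,R,U,D,U,D], [L,L,U,D,U,D], [U,D,U,D,U,D], [R,U,D,R,U,D], [L,U,D,L,U,D]],
    [[R,U,D,L,L,R], [L,U,D,U,D,L], [D,U,D,U,D,U], [D,R,U,D,R,U], [D,L,R,R,L,U]],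
    [[R,R,U,D,U,D], [L,L,R,U,D,R], [U,D,L,U,D,L], [R,R,R,U,D,R], [L,L,L,U,D,L]],
    [[R,L,L,R,L,L], [L,U,D,L,R,R], [U,D,U,D,L,L], [R,U,D,R,U,D], [L,R,R,L,R,R]],
    [[R,R,L,U,D,L], [L,L,U,D,R,R], [R,U,D,R,L,L], [L,U,D,L,U,D], [D,R,U,D,R,U]],
    [[R,U,D,R,L,L], [L,R,R,L,R,R], [R,L,L,R,L,L], [L,U,D,L,U,D], [D,R,R,U,D,U]],
    [[R,L,U,D,L,R], [L,R,U,D,R,L], [D,L,U,D,L,U], [U,D,U,D,U,D], [U,D,R,U,D,R]]]"

definition grids_2R :: "grid list" where
  "grids_2R = [
    [[R,R,R,U,D,R], [L,L,L,U,D,L], [D,U,D,U,D,U], [U,D,U,D,R,R], [U,D,U,D,L,L]],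
    [[D,R,U,D,R,U], [D,L,R,R,L,U], [U,D,L,L,U,D], [R,U,D,R,U,D], [L,U,D,L,U,D]],
    [[R,R,L,L,U,D], [L,L,U,D,U,D], [R,R,R,R,R,R], [L,L,L,L,L,L], [D,U,D,R,R,U]],
    [[R,R,R,R,L,L], [L,L,L,L,R,R], [U,D,U,D,L,L], [D,U,D,U,D,U], [D,R,R,U,D,U]],
    [[D,R,L,L,R,U], [R,L,U,D,L,R], [L,U,D,U,D,L], [R,R,R,U,D,R], [L,L,L,R,R,L]],
    [[L,R,R,U,D,L], [D,L,L,U,D,U], [R,R,U,D,R,R], [L,L,R,R,L,L], [R,R,L,L,U,D]],
    [[L,R,R,L,L,L], [R,L,L,R,U,D], [L,U,D,L,U,D], [U,D,U,D,U,D], [R,R,R,R,U,D]],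
    [[D,R,R,R,R,U], [D,L,L,L,L,U], [D,R,R,R,R,U], [D,L,L,L,L,U], [U,D,U,D,U,D]],
    [[R,R,U,D,U,D], [L,L,R,R,U,D], [R,R,L,L,U,D], [L,L,R,U,D,R], [U,D,L,U,D,L]],
    [[R,R,U,D,R,R], [L,L,U,D,L,L], [U,D,U,D,U,D], [D,R,U,D,R,U], [D,L,U,D,L,U]],
    [[D,R,R,U,D,U], [R,L,L,R,R,R], [L,R,R,L,L,L], [R,L,L,R,R,R], [L,U,D,L,L,L]],
    [[R,R,U,D,U,D], [L,L,U,D,R,R], [R,U,D,R,L,L], [L,U,D,L,U,D], [U,D,U,D,U,D]],
    [[D,R,R,U,D,U], [D,L,L,U,D,U], [U,D,R,U,D,R], [U,D,L,U,D,L], [D,U,D,U,D,U]],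
    [[R,R,L,L,L,L], [L,L,R,U,D,R], [U,D,L,R,R,L], [R,U,D,L,L,R], [L,R,R,R,R,L]],
    [[R,R,R,R,U,D], [L,L,L,L,U,D], [D,U,D,U,D,U], [D,R,R,R,R,U], [D,L,L,L,L,U]],
    [[L,R,U,D,R,L], [D,L,U,D,L,U], [D,U,D,R,R,U], [U,D,R,L,L,R], [R,R,L,U,D,L]],
    [[D,R,R,L,L,U], [D,L,L,R,R,U], [R,U,D,L,L,R], [L,R,U,D,R,L], [D,L,R,R,L,U]],
    [[R,R,L,L,R,R], [L,L,R,R,L,L], [D,R,L,L,R,U], [D,L,U,D,L,U], [D,U,D,R,R,U]],
    [[R,R,U,D,L,L], [L,L,U,D,U,D], [D,R,R,U,D,U], [R,L,L,R,U,D], [L,R,R,L,U,D]],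
    [[R,R,R,U,D,R], [L,L,L,U,D,L], [R,U,D,R,U,D], [L,R,R,L,U,D], [D,L,L,U,D,U]],
    [[L,R,R,U,D,L], [R,L,L,U,D,R], [L,U,D,U,D,L], [D,U,D,U,D,U], [R,R,U,D,U,D]],
    [[R,R,L,L,U,D], [L,L,U,D,R,R], [U,D,U,D,L,L], [U,D,R,U,D,R], [U,D,L,R,R,L]],
    [[R,R,U,D,U,D], [L,L,R,R,U,D], [U,D,L,L,R,R], [R,R,U,D,L,L], [L,L,U,D,U,D]],
    [[D,R,R,R,R,U], [R,L,L,L,L,R], [L,R,U,D,R,L], [R,L,U,D,L,R], [L,U,D,U,D,L]],
    [[R,R,R,R,R,R], [L,L,L,L,L,L], [R,U,D,U,D,R], [L,U,D,R,R,L], [D,U,D,L,L,U]],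
    [[L,R,R,R,R,L], [D,L,L,L,L,U], [U,D,R,R,U,D], [U,D,L,L,R,R], [R,R,U,D,L,L]],
    [[R,R,L,U,D,L], [L,L,U,D,U,D], [U,D,U,D,U,D], [U,D,R,R,U,D], [D,R,L,L,R,U]],
    [[R,R,R,L,L,R], [L,L,L,R,R,L], [D,U,D,L,L,U], [D,U,D,U,D,U], [U,D,R,R,U,D]],
    [[R,R,L,R,R,L], [L,L,R,L,L,R], [U,D,L,U,D,L], [U,D,U,D,U,D], [D,R,U,D,R,U]],
    [[L,R,R,L,U,D], [R,L,L,U,D,R], [L,U,D,R,R,L], [D,U,D,L,L,U], [R,U,D,R,U,D]],
    [[D,R,R,U,D,U], [R,L,L,R,U,D], [L,U,D,L,R,R], [U,D,R,R,L,L], [U,D,L,L,U,D]],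
    [[L,R,L,L,R,L], [D,L,R,R,L,U], [R,R,L,L,U,D], [L,L,R,U,D,R], [R,R,L,R,R,L]],
    [[R,R,R,L,L,R], [L,L,L,U,D,L], [U,D,R,R,R,R], [R,R,L,L,L,L], [L,L,R,R,U,D]],
    [[L,R,R,L,U,D], [D,L,L,R,R,U], [R,U,D,L,L,R], [L,R,R,U,D,L], [R,L,L,R,U,D]],
    [[D,R,U,D,R,U], [R,L,R,R,L,R], [L,R,L,L,R,L], [D,L,U,D,L,U], [D,U,D,U,D,U]],
    [[R,R,L,U,D,L], [L,L,R,R,R,R], [U,D,L,L,L,L], [U,D,U,D,U,D], [D,R,U,D,R,U]],
    [[L,R,R,L,R,R], [R,L,L,R,L,L], [L,U,D,L,U,D], [U,D,U,D,U,D], [R,U,D,R,U,D]],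
    [[R,R,U,D,U,D], [L,L,R,U,D,R], [U,D,L,U,D,L], [R,U,D,R,R,R], [L,U,D,L,L,L]],
    [[R,R,L,L,U,D], [L,L,U,D,U,D], [D,R,U,D,R,U], [D,L,U,D,L,U], [D,U,D,R,R,U]],
    [[R,R,U,D,U,D], [L,L,U,D,U,D], [U,D,U,D,U,D], [D,U,D,U,D,U], [D,U,D,U,D,U]]]"

lemma certified_1U: "certifies ((1, 1), U) grids_1U" by code_simp
lemma certified_2U: "certifies ((2, 1), U) grids_2U" by code_simp
lemma certified_1R: "certifies ((1, 1), R) grids_1R" by code_simp
lemma certified_2R: "certifies ((2, 1), R) grids_2R" by code_simp

section \<open>The base case\<close>

definition extendable_edge :: "nat \<Rightarrow> (nat \<times> nat) set \<Rightarrow> bool" where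
  "extendable_edge n e \<longleftrightarrow> (\<forall>M. small_matching n M \<and> e \<in> M \<longrightarrow> extends n M)"

lemma extendable_edge_automorphism:
  assumes "automorphism n h" "extendable_edge n (h ` e)"
  shows "extendable_edge n e"
  unfolding extendable_edge_def
proof (intro allI impI, elim conjE)
  fix M assume M: "small_matching n M" "e \<in> M"
  have "extends n ((`) h ` M)"
    using assms(2) small_matching_automorphism[OF assms(1) M(1)] M(2) unfolding extendable_edge_def by simp
  moreover have "M \<subseteq> links n" using M unfolding small_matching_def by blast
  ultimately show "extends n M" using extends_automorphism[OF assms(1)] by simp
qed

text \<open>In the first column the reflection and the half turn bring every row, and every edge of the
  6-cycle, to one of two representatives. A downward edge is an upward edge with its ends exchanged,
  but it has to be carried along in the induction over the columns because up and down are
  exchanged when column \<open>n\<close> moves onto column \<open>1\<close>.\<close>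

lemma extendable_edge_orbits:
  assumes U: "extendable_edge n {(1, 1), (2, 1)}" "extendable_edge n {(2, 1), (3, 1)}"
    and R: "extendable_edge n {(1, 1), (1, 2)}" "extendable_edge n {(2, 1), (2, 2)}"
    and n: "n \<ge> 2" and e: "e \<in> links n"
  shows "extendable_edge n e"
proof -
  note mir = extendable_edge_automorphism[OF reflection_automorphism]
  note tur = extendable_edge_automorphism[OF half_turn_automorphism]
  (* The reflection takes row 6 to row 2, and the half turn takes rows 3, 4, 5 to rows 6, 1, 2. *)
  have first: "extendable_edge n {(i, 1), (up i, 1)} \<and> extendable_edge n {(i, 1), (i, 2)}" if "i \<in> {1..6}" for i
  proof -
    have 6: "extendable_edge n {(6, 1), (1, 1)}" "extendable_edge n {(6, 1), (6, 2)}"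
      by (rule mir; use U R in \<open>simp add: insert_commute\<close>)+
    have "extendable_edge n {(3, 1), (4, 1)}" "extendable_edge n {(3, 1), (3, 2)}"
      "extendable_edge n {(4, 1), (5, 1)}" "extendable_edge n {(4, 1), (4, 2)}"
      "extendable_edge n {(5, 1), (6, 1)}" "extendable_edge n {(5, 1), (5, 2)}"
      by (rule tur; use U R 6 in \<open>simp add: turn_def insert_commute\<close>)+
    then show ?thesis using that[unfolded rows] U R 6 by (elim disjE) simp_all
  qed
  define Q where "Q j \<longleftrightarrow> (\<forall>i \<in> {1..6}. \<forall>d \<in> {U, D, R}. extendable_edge n {(i, j), step n d (i, j)})" for j
  have Q1: "Q 1"
    unfolding Q_def
  proof (intro ballI)
    fix i d assume i: "i \<in> {1..6::nat}" and d: "d \<in> {U, D, R}"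
    have "extendable_edge n {(i, 1), (down i, 1)}"
      using first[OF row_laws(2)[OF i]] row_laws(5)[OF i] by (simp add: insert_commute)
    then show "extendable_edge n {(i, 1), step n d (i, 1)}" using first[OF i] d n by (auto simp flip: numeral_2_eq_2)
  qed
  have shift: "Q j" if "Q (next_col n j)" for j
    unfolding Q_def
  proof (intro ballI)
    fix i d assume i: "i \<in> {1..6::nat}" and d: "d \<in> {U, D, R}"
    define i' where "i' = (if j = n then mirror i else i)"
    define d' where "d' = (if j = n then (case d of U \<Rightarrow> D | D \<Rightarrow> U | _ \<Rightarrow> d) else d)"
    have R: "step n R (i, j) = (i', next_col n j)" by (simp add: next_col_def i'_def)
    have "step n R (step n d (i, j)) = step n d' (step n R (i, j))"
      using d i by (auto simp: d'_def row_laws)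
    then have img: "step n R ` {(i, j), step n d (i, j)} = {(i', next_col n j), step n d' (i', next_col n j)}"
      unfolding R[symmetric] by simp
    have "i' \<in> {1..6}" unfolding i'_def using row_laws(3)[OF i] i by simp
    moreover have "d' \<in> {U, D, R}" unfolding d'_def using d by auto
    ultimately have "extendable_edge n {(i', next_col n j), step n d' (i', next_col n j)}"
      using that[unfolded Q_def] by (elim ballE[of _ _ i'] ballE[of _ _ d']) simp_all
    then have "extendable_edge n (step n R ` {(i, j), step n d (i, j)})" unfolding img .
    then show "extendable_edge n {(i, j), step n d (i, j)}"
      by (rule extendable_edge_automorphism[OF shift_automorphism])
  qed
  have Qn: "Q n" using shift[of n] Q1 by (simp add: next_col_def)
  have "Q j" if "j \<le> n" for j
    using that
  proof (induction rule: inc_induct)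
    case base
    show ?case by (rule Qn)
  next
    case (step k)
    then show ?case using shift[of k] by (simp add: next_col_def)
  qed
  moreover obtain i j d where "e = {(i, j), step n d (i, j)}" "i \<in> {1..6}" "j \<in> {1..n}" "d \<in> {U, R}"
    using e unfolding links_forward cells_def by blast
  ultimately show ?thesis unfolding Q_def by auto
qed

text \<open>The empty matching is treated as a part of a matching with one edge.\<close>

lemma extends_five:
  assumes "small_matching 5 M"
  shows "extends 5 M"
proof -
  have cell: "(i, 1) \<in> cells 5" if "i \<in> {1, 2}" for i using that by (auto simp: cells_def)
  have "extendable_edge 5 {(1, 1), (2, 1)}" "extendable_edge 5 {(2, 1), (3, 1)}"
    "extendable_edge 5 {(1, 1), (1, 2)}" "extendable_edge 5 {(2, 1), (2, 2)}"
    using extends_of_certificate[OF certified_1U] extends_of_certificate[OF certified_2U]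
      extends_of_certificate[OF certified_1R] extends_of_certificate[OF certified_2R] cell
    unfolding extendable_edge_def edge_of_def by (simp_all flip: numeral_2_eq_2)
  note all = extendable_edge_orbits[OF this]
  show ?thesis
  proof (cases "M = {}")
    case False
    then obtain e where "e \<in> M" by blast
    moreover from this have "e \<in> links 5" using assms unfolding small_matching_def by blast
    ultimately show ?thesis using all[of e] assms unfolding extendable_edge_def by simp
  next
    case True
    have "{(1, 1), step 5 U (1, 1)} \<in> links 5" by (rule linkI) (simp add: cells_def)
    then have "{(1, 1), (2, 1)} \<in> links 5" by simp
    then have "small_matching 5 {{(1, 1), (2, 1)}}" "extendable_edge 5 {(1, 1), (2, 1)}"
      using all unfolding small_matching_def by simp_all
    then have "extends 5 {{(1, 1), (2, 1)}}" unfolding extendable_edge_def by blast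
    then show ?thesis using True unfolding extends_def by auto
  qed
qed

section \<open>All odd numbers of columns\<close>

lemma small_matching_extends:
  assumes "n \<ge> 5" "odd n" "small_matching n M"
  shows "extends n M"
proof -
  obtain k where "n = 5 + 2 * k"
  proof -
    have "even (n - 5)" using assms by simp
    then obtain k where "n - 5 = 2 * k" by blast
    then show thesis using that[of k] assms by simp
  qed
  moreover have "small_matching (5 + 2 * k) M \<Longrightarrow> extends (5 + 2 * k) M" for M
  proof (induction k arbitrary: M)
    case 0
    then show ?case using extends_five by simp
  next
    case (Suc k)
    then show ?case using small_matching_extends_step[of "5 + 2 * k" M] by (simp add: add.commute)
  qed
  ultimately show ?thesis using assms by simp
qed

theorem theorem3p4:
  fixes n :: nat
  assumes "n \<ge> 5" and "odd n"
  shows "extendable 3 (bow_tie 6 n)"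
proof -
  have "\<exists>M'. perfect_matching (bow_tie 6 n) M' \<and> M \<subseteq> M'" if "small_matching n M" for M
    using perfect_matching_of_mate[of n M] small_matching_extends[OF assms that] that assms(1)
    unfolding small_matching_def by simp
  moreover have "small_matching n {}" unfolding small_matching_def by simp
  moreover have "small_matching n M" if "k_matching 3 (bow_tie 6 n) M" for M
    using that edges_bow_tie[of n] assms(1)
    unfolding k_matching_def matching_def small_matching_def by simp
  ultimately show ?thesis unfolding extendable_def by blast
qed

end
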